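(* Let $r=\frac1{25}$ and let $n\in\mathbb N$ with $n\ge3$. Then for every admissible $I$ the set $\beta_n(I)$ is an optimal set of $n$-means for $P$, and the corresponding quantization error is $V_n=V(P;\beta_n(I))$, where $$V(P;\beta_n(I))=\frac{1}{3^{\ell(n)}}\,r^{2\ell(n)}\Big((2\cdot3^{\ell(n)}-n)V+(n-3^{\ell(n)})V(P;\beta_2)\Big)\quad\text{if }3^{\ell(n)}\le n\le2\cdot3^{\ell(n)},$$ $$V(P;\beta_n(I))=\frac{1}{3^{\ell(n)}}\,r^{2\ell(n)}\Big((3^{\ell(n)+1}-n)V(P;\beta_2)+(n-2\cdot3^{\ell(n)})V(P;\beta_3)\Big)\quad\text{if }2\cdot3^{\ell(n)}\le n<3^{\ell(n)+1}.$$
   Context: For $0<r<\frac13$ and $j\in\{1,2,3\}$ let $S_j(x)=rx+\frac{j-1}{2}(1-r)$, $x\in\mathbb R$. Let $P$ be the unique Borel probability measure on $\mathbb R$ with $P=\frac13\sum_{j=1}^3 P\circ S_j^{-1}$, let $X$ be a random variable with distribution $P$, and let $V=V(X)$ be its variance. For a word $\sigma=\sigma_1\cdots\sigma_k\in\{1,2,3\}^k$ put $S_\sigma=S_{\sigma_1}\circ\cdots\circ S_{\sigma_k}$ ($S_\emptyset$ is the identity), $J_\sigma=S_\sigma([0,1])$, $a(\sigma)=S_\sigma(\frac12)$. For words $\sigma,\tau,\dots,\rho$ put $a(\sigma,\tau,\dots,\rho)=E(X\mid X\in J_\sigma\cup J_\tau\cup\cdots\cup J_\rho)$. For a finite set $\alpha\subset\mathbb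 R$ let $V(P;\alpha)=\int\min_{a\in\alpha}(x-a)^2\,dP(x)$, and $V_n=\inf\{V(P;\alpha):\alpha\subset\mathbb R,\ \mathrm{card}(\alpha)\le n\}$. A set $\alpha$ with $\mathrm{card}(\alpha)\le n$ is an optimal set of $n$-means for $P$ if $V(P;\alpha)=V_n$. For $n\ge3$ let $\ell(n)$ be the unique natural number with $3^{\ell(n)}\le n<3^{\ell(n)+1}$. A set $I\subseteq\{1,2,3\}^{\ell(n)}$ is called admissible (for $n$) if $\mathrm{card}(I)=n-3^{\ell(n)}$ when $3^{\ell(n)}\le n\le 2\cdot3^{\ell(n)}$, and $\mathrm{card}(I)=n-2\cdot3^{\ell(n)}$ when $2\cdot3^{\ell(n)}<n<3^{\ell(n)+1}$. Let $\beta_2=\{a(1),a(2,3)\}$, $\beta_3=\{a(1),a(2),a(3)\}$. For $n\ge3$ and admissible $I$, $$\beta_n(I)=\{a(\omega):\omega\in\{1,2,3\}^{\ell(n)}\setminus I\}\cup\bigcup_{\omega\in I}S_\omega(\beta_2)\quad\text{if }3^{\ell(n)}\le n\le2\cdot3^{\ell(n)},$$ $$\beta_n(I)=\bigcup_{\omega\in\{1,2,3\}^{\ell(n)}\setminus I}S_\omega(\beta_2)\cup\bigcup_{\omega\in I}S_\omega(\beta_3)\quad\text{if }2\cdot3^{\ell(n)}<n<3^{\ell(n)+1}.$$ *)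

theory Defs
  imports "HOL-Probability.Probability"
begin

definition S :: "real \<Rightarrow> nat \<Rightarrow> real \<Rightarrow> real" where
  "S r j x = r * x + (real j - 1) / 2 * (1 - r)"

definition self_similar_measure :: "real \<Rightarrow> real measure \<Rightarrow> bool" where
  "self_similar_measure r P \<longleftrightarrow>
     prob_space P \<and> sets P = sets borel \<and>
     (\<forall>A\<in>sets borel. measure P A = 1 / 3 * (\<Sum>j\<in>{1,2,3}. measure (distr P borel (S r j)) A))"

text \<open>Words over the alphabet 1, 2, 3 are lists; the first letter is the outermost map.\<close>

definition words :: "nat \<Rightarrow> nat list set" where
  "words k = {\<sigma>. length \<sigma> = k \<and> set \<sigma> \<subseteq> {1,2,3}}"

primrec S_word :: "real \<Rightarrow> nat list \<Rightarrow> real \<Rightarrow> real" where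
  "S_word r [] = id"
| "S_word r (j # \<sigma>) = S r j \<circ> S_word r \<sigma>"

definition J :: "real \<Rightarrow> nat list \<Rightarrow> real set" where
  "J r \<sigma> = S_word r \<sigma> ` {0..1}"

definition a_pt :: "real \<Rightarrow> nat list \<Rightarrow> real" where
  "a_pt r \<sigma> = S_word r \<sigma> (1 / 2)"

text \<open>The random variable \<open>X\<close> with distribution \<open>P\<close> is realised as the identity on the
  probability space \<open>P\<close>. For a set \<open>W\<close> of words, \<open>a_mean P r W\<close> is the elementary
  conditional expectation of \<open>X\<close> given the event that \<open>X\<close> lies in one of the
  \<open>J r \<sigma>\<close>, \<open>\<sigma> \<in> W\<close>.\<close>

definition a_mean :: "real measure \<Rightarrow> real \<Rightarrow> nat list set \<Rightarrow> real" where
  "a_mean P r W = (LINT x:(\<Union>\<sigma>\<in>W. J r \<sigma>)|P. x) / measure P (\<Union>\<sigma>\<in>W. J r \<sigma>)"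

definition distortion :: "real measure \<Rightarrow> real set \<Rightarrow> real" where
  "distortion P \<alpha> = (LINT x|P. Min ((\<lambda>a. (x - a)\<^sup>2) ` \<alpha>))"

text \<open>The empty set is excluded: its distortion is infinite by convention, while \<open>Min {}\<close> is
  an unspecified real.\<close>

definition quant_error :: "real measure \<Rightarrow> nat \<Rightarrow> real" where
  "quant_error P n = (INF \<alpha>\<in>{\<alpha>. finite \<alpha> \<and> \<alpha> \<noteq> {} \<and> card \<alpha> \<le> n}. distortion P \<alpha>)"

definition optimal_set_of_means :: "real measure \<Rightarrow> nat \<Rightarrow> real set \<Rightarrow> bool" where
  "optimal_set_of_means P n \<alpha> \<longleftrightarrow>
     finite \<alpha> \<and> \<alpha> \<noteq> {} \<and> card \<alpha> \<le> n \<and> distortion P \<alpha> = quant_error P n"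

definition ell :: "nat \<Rightarrow> nat" where
  "ell n = (THE l. 3 ^ l \<le> n \<and> n < 3 ^ (l + 1))"

definition admissible :: "nat \<Rightarrow> nat list set \<Rightarrow> bool" where
  "admissible n I \<longleftrightarrow> I \<subseteq> words (ell n) \<and>
     (3 ^ ell n \<le> n \<and> n \<le> 2 * 3 ^ ell n \<longrightarrow> card I = n - 3 ^ ell n) \<and>
     (2 * 3 ^ ell n < n \<and> n < 3 ^ (ell n + 1) \<longrightarrow> card I = n - 2 * 3 ^ ell n)"

definition beta2 :: "real measure \<Rightarrow> real \<Rightarrow> real set" where
  "beta2 P r = {a_pt r [1], a_mean P r {[2], [3]}}"

definition beta3 :: "real \<Rightarrow> real set" where
  "beta3 r = {a_pt r [1], a_pt r [2], a_pt r [3]}"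

definition beta :: "real measure \<Rightarrow> real \<Rightarrow> nat \<Rightarrow> nat list set \<Rightarrow> real set" where
  "beta P r n I =
     (if n \<le> 2 * 3 ^ ell n
      then a_pt r ` (words (ell n) - I) \<union> (\<Union>\<omega>\<in>I. S_word r \<omega> ` beta2 P r)
      else (\<Union>\<omega>\<in>words (ell n) - I. S_word r \<omega> ` beta2 P r) \<union>
           (\<Union>\<omega>\<in>I. S_word r \<omega> ` beta3 r))"

end

theory Submission
  imports Defs
begin

text \<open>
  Write \<open>V\<^sub>k = V(P;\<beta>\<^sub>k)\<close>. The optimal errors form a convex decreasing sequence \<open>err\<close>: its decrements are
  \<open>V - V\<^sub>2\<close>, \<open>V\<^sub>2 - V\<^sub>3\<close>, and from then on \<open>gap k = (r\<^sup>2 / 3) gap (k div 3)\<close>. Convexity gives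
  \<open>(r\<^sup>2 / 3) (err k\<^sub>1 + err k\<^sub>2 + err k\<^sub>3) \<ge> err (k\<^sub>1 + k\<^sub>2 + k\<^sub>3)\<close>.

  That \<open>err (card \<alpha>)\<close> bounds the distortion of \<open>\<alpha>\<close> from below is proved by induction on
  \<open>card \<alpha>\<close>. If some point of \<open>\<alpha>\<close> is nearest to points of two of the three level-one
  cylinders, then one cylinder is far from all of \<open>\<alpha>\<close>, and the distortion already exceeds
  the one for three means. Otherwise \<open>\<alpha>\<close> splits into three disjoint parts, each serving one
  cylinder, and self-similarity with convexity applies. Two means are treated by hand,
  according to the position of the midpoint of the two points.

  Serving each cylinder \<open>J\<^sub>\<omega>\<close> only by the points of \<open>\<beta>\<^sub>n(I)\<close> that come from \<open>\<omega>\<close> bounds the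
  distortion of \<open>\<beta>\<^sub>n(I)\<close> by \<open>err n\<close> from above, so nearest points in \<open>\<beta>\<^sub>n(I)\<close> need not be
  determined.
\<close>

subsection \<open>A convex self-similar sequence\<close>

text \<open>\<open>q\<close> scales the error inside one level-one cylinder, \<open>v\<close> is the
  error of one mean, \<open>d\<^sub>1\<close> and \<open>d\<^sub>2\<close> are the drops to two and
  to three means. The inequalities make the drops decrease; \<open>v_eq\<close> says that three
  means reproduce the situation of one mean, scaled by \<open>3 * q\<close>.\<close>

locale gap_sequence =
  fixes q v d\<^sub>1 d\<^sub>2 :: real
  assumes q_nonneg: "0 \<le> q" and d2_nonneg: "0 \<le> d\<^sub>2" and d2_le_d1: "d\<^sub>2 \<le> d\<^sub>1"
    and q_d1_le_d2: "q * d\<^sub>1 \<le> d\<^sub>2" and v_eq: "v - d\<^sub>1 - d\<^sub>2 = 3 * q * v"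
begin

text \<open>The drop from \<open>k\<close> to \<open>k + 1\<close> means. With \<open>k\<close>
  means spread evenly, a cylinder holding \<open>k div 3\<close> of them receives the next one,
  hence the recursion. The value at 0 is a filler that keeps the sequence antitone.\<close>

fun gap :: "nat \<Rightarrow> real" where
  "gap k = (if k \<le> 1 then d\<^sub>1 else if k = 2 then d\<^sub>2 else q * gap (k div 3))"

declare gap.simps [simp del]

lemma gap_low [simp]: "gap 0 = d\<^sub>1" "gap 1 = d\<^sub>1" "gap (Suc 0) = d\<^sub>1" "gap 2 = d\<^sub>2"
  by (simp_all add: gap.simps)

lemma gap_div: "3 \<le> k \<Longrightarrow> gap k = q * gap (k div 3)"
  by (subst gap.simps) auto

lemma gap_nonneg: "0 \<le> gap k"
proof (induction k rule: less_induct)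
  case (less k)
  consider "k \<le> 1" | "k = 2" | "3 \<le> k" by linarith
  then show ?case
    using less[of "k div 3"] q_nonneg d2_nonneg d2_le_d1
    by cases (auto simp: gap.simps[of k])
qed

lemma gap_Suc_le: "gap (Suc k) \<le> gap k"
proof (induction k rule: less_induct)
  case (less k)
  consider "k = 0" | "k = 1" | "k = 2" | "3 \<le> k" by linarith
  then show ?case
  proof cases
    case 3
    \<comment> \<open>The one place where the given drops meet the recursion:
      \<open>gap 3 = q * gap 1\<close>.\<close>
    then show ?thesis using q_d1_le_d2 gap_div[of 3] by simp
  next
    case 4
    have "Suc k div 3 = k div 3 \<or> Suc k div 3 = Suc (k div 3)" by linarith
    then have "gap (Suc k div 3) \<le> gap (k div 3)"
      using less[of "k div 3"] 4 by auto
    then show ?thesis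
      using 4 q_nonneg by (simp add: gap_div mult_left_mono)
  qed (use d2_le_d1 in \<open>auto simp: numeral_2_eq_2[symmetric]\<close>)
qed

lemma gap_antimono: "i \<le> j \<Longrightarrow> gap j \<le> gap i"
  by (rule lift_Suc_antimono_le[of gap, OF gap_Suc_le])

definition err :: "nat \<Rightarrow> real" where
  "err n = v - (\<Sum>k = 1..<n. gap k)"

lemma err_Suc: "1 \<le> n \<Longrightarrow> err (Suc n) = err n - gap n"
  by (simp add: err_def)

lemma err_1 [simp]: "err 1 = v" "err (Suc 0) = v"
  by (simp_all add: err_def)

lemma err_2: "err 2 = v - d\<^sub>1"
  using err_Suc[of 1] by (simp add: numeral_2_eq_2)

lemma err_3: "err 3 = 3 * q * v"
  using err_Suc[of 2] err_2 v_eq by simp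

lemma err_antimono:
  assumes "1 \<le> m" "m \<le> n"
  shows "err n \<le> err m"
  using assms(2)
proof (induction rule: dec_induct)
  case (step k)
  then show ?case using err_Suc[of k] gap_nonneg[of k] assms(1) by linarith
qed simp

text \<open>Discrete convexity: from \<open>p\<close> on to the right every drop is at most
  \<open>gap p\<close>, to the left of \<open>p\<close> at least \<open>gap p\<close>.\<close>

lemma err_supporting_line:
  assumes "1 \<le> p" "1 \<le> k"
  shows "err p - gap p * (real k - real p) \<le> err k"
proof (cases "p \<le> k")
  case True
  then show ?thesis
  proof (induction rule: dec_induct)
    case (step m)
    then show ?case
      using err_Suc[of m] gap_antimono[of p m] assms(1) by (auto simp: algebra_simps)
  qed simp
next
  case False
  then have "k \<le> p" by simp
  then show ?thesis
  proof (induction rule: inc_induct)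
    case (step m)
    then show ?case
      using err_Suc[of m] gap_antimono[of m p] assms(2) by (auto simp: algebra_simps)
  qed simp
qed

text \<open>The numbers \<open>3 * p\<close>, \<open>3 * p + 1\<close>, \<open>3 * p + 2\<close>
  share the quotient \<open>p\<close>, hence the drop. The right end \<open>s = 3\<close> is
  included, which links one block to the next.\<close>

lemma err_3_mult_add:
  assumes "1 \<le> p" "s \<le> 3"
  shows "err (3 * p + s) = err (3 * p) - real s * (q * gap p)"
  using assms(2)
proof (induction s)
  case (Suc s)
  have "(3 * p + s) div 3 = p" using Suc by simp
  then have "gap (3 * p + s) = q * gap p" using gap_div[of "3 * p + s"] assms by simp
  then show ?case using Suc err_Suc[of "3 * p + s"] assms by (simp add: algebra_simps)
qed simp

lemma err_3_mult:
  assumes "1 \<le> p"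
  shows "err (3 * p) = 3 * q * err p"
  using assms
proof (induction p rule: dec_induct)
  case base
  then show ?case using err_3 by simp
next
  case (step m)
  have "err (3 * Suc m) = err (3 * m) - 3 * (q * gap m)"
    using err_3_mult_add[of m 3] step by (simp add: algebra_simps)
  also have "\<dots> = 3 * q * (err m - gap m)"
    using step by (simp add: algebra_simps)
  finally show ?case using err_Suc[of m] step by simp
qed

text \<open>Jensen, with the supporting line at \<open>p = n div 3\<close> used for all three terms.
  Only the total deviation \<open>s\<close> of the arguments from \<open>p\<close> enters, and
  \<open>err\<close> is linear from \<open>3 * p\<close> to \<open>3 * p + 3\<close> with slope
  \<open>- q * gap p\<close>, so \<open>q\<close> times the sum of the three lines is exactly
  \<open>err n\<close>.\<close>

lemma err_split_le:
  assumes "1 \<le> k\<^sub>1" "1 \<le> k\<^sub>2" "1 \<le> k\<^sub>3"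
  shows "err (k\<^sub>1 + k\<^sub>2 + k\<^sub>3) \<le> q * (err k\<^sub>1 + err k\<^sub>2 + err k\<^sub>3)"
proof -
  define n p s where "n = k\<^sub>1 + k\<^sub>2 + k\<^sub>3" and "p = n div 3" and "s = n mod 3"
  have p: "1 \<le> p" and s: "s \<le> 3" and n: "n = 3 * p + s"
    using assms by (auto simp: n_def p_def s_def)
  have rn: "real k\<^sub>1 + real k\<^sub>2 + real k\<^sub>3 = 3 * real p + real s"
    using n unfolding n_def by linarith
  have "3 * err p - gap p * real s = (err p - gap p * (real k\<^sub>1 - real p))
      + (err p - gap p * (real k\<^sub>2 - real p)) + (err p - gap p * (real k\<^sub>3 - real p))"
    using arg_cong[OF rn, of "\<lambda>z. gap p * z"] by (simp add: algebra_simps)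
  also have "\<dots> \<le> err k\<^sub>1 + err k\<^sub>2 + err k\<^sub>3"
    using err_supporting_line p assms by (intro add_mono) auto
  finally have "q * (3 * err p - gap p * real s) \<le> q * (err k\<^sub>1 + err k\<^sub>2 + err k\<^sub>3)"
    using q_nonneg by (rule mult_left_mono)
  moreover have "err n = q * (3 * err p - gap p * real s)"
    using err_3_mult_add[OF p s] err_3_mult[OF p] n by (simp add: algebra_simps)
  ultimately show ?thesis by (simp add: n_def)
qed

lemma err_pow3_mult: "1 \<le> p \<Longrightarrow> err (3 ^ l * p) = (3 * q) ^ l * err p"
proof (induction l)
  case (Suc l)
  then show ?case using err_3_mult[of "3 ^ l * p"] by (simp add: mult.assoc)
qed simp

text \<open>Deleting the last \<open>l\<close> ternary digits of such a \<open>k\<close> leaves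
  \<open>p\<close>; each deleted digit costs a factor \<open>q\<close>.\<close>

lemma gap_pow3:
  assumes "1 \<le> p" "3 ^ l * p \<le> k" "k < 3 ^ l * Suc p"
  shows "gap k = q ^ l * gap p"
  using assms
proof (induction l arbitrary: k)
  case (Suc l)
  have "3 ^ l * p \<le> k div 3" "k div 3 < 3 ^ l * Suc p"
    using Suc.prems by auto
  moreover have "3 \<le> k"
  proof -
    have "1 \<le> 3 ^ l * p" using Suc.prems(1) by (simp add: Suc_le_eq)
    then have "3 * 1 \<le> 3 * (3 ^ l * p)" by (rule mult_le_mono2)
    then show ?thesis using Suc.prems(2) unfolding power_Suc mult.assoc by linarith
  qed
  ultimately show ?case using Suc.IH Suc.prems(1) gap_div[of k] by simp
qed (auto simp: less_Suc_eq_le le_antisym)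

text \<open>The drop is constant on the block, so \<open>err\<close> is linear there, right end
  included. The blocks with \<open>p = 1\<close> and \<open>p = 2\<close> are the two ranges of the
  theorem.\<close>

lemma err_pow3_linear:
  assumes "1 \<le> p" "i \<le> 3 ^ l"
  shows "err (3 ^ l * p + i) = (3 * q) ^ l * err p - real i * (q ^ l * gap p)"
  using assms(2)
proof (induction i)
  case 0
  then show ?case using err_pow3_mult[OF assms(1)] by simp
next
  case (Suc i)
  have "gap (3 ^ l * p + i) = q ^ l * gap p"
    using Suc.prems assms(1) by (intro gap_pow3) auto
  moreover have "1 \<le> 3 ^ l * p + i" using assms(1) by (simp add: Suc_le_eq)
  ultimately show ?case using Suc err_Suc[of "3 ^ l * p + i"] by (simp add: algebra_simps)
qed

end

subsection \<open>The self-similar measure\<close>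

lemma S_alt: "S r 1 x = r * x" "S r 2 x = r * x + (1 - r) / 2" "S r 3 x = r * x + (1 - r)"
  by (simp_all add: S_def)

lemma S_measurable [measurable]: "S r j \<in> borel_measurable borel"
  unfolding S_def[abs_def] by measurable

lemma continuous_bounded_unit:
  fixes f :: "real \<Rightarrow> real"
  assumes "continuous_on UNIV f"
  shows "\<exists>B. \<forall>x\<in>{0..1}. \<bar>f x\<bar> \<le> B"
proof -
  have "compact (f ` {0..1})"
    by (rule compact_continuous_image[OF continuous_on_subset[OF assms]]) auto
  then have "bounded (f ` {0..1})" by (rule compact_imp_bounded)
  then show ?thesis by (simp add: bounded_iff)
qed

locale self_similar =
  fixes r :: real and P :: "real measure"
  assumes r_pos: "0 < r" and r_less: "r < 1 / 3" and self_similar: "self_similar_measure r P"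

sublocale self_similar \<subseteq> prob_space P
  using self_similar by (simp add: self_similar_measure_def)

context self_similar
begin

lemma sets_P [measurable_cong]: "sets P = sets borel"
  using self_similar by (simp add: self_similar_measure_def)

lemma space_P [simp]: "space P = UNIV"
  using sets_eq_imp_space_eq[OF sets_P] by simp

lemma measure_UNIV [simp]: "measure P UNIV = 1"
  using prob_space by simp

lemma measure_self_similar:
  assumes "A \<in> sets borel"
  shows "3 * measure P A
    = measure P (S r 1 -` A) + measure P (S r 2 -` A) + measure P (S r 3 -` A)"
proof -
  have "measure (distr P borel (S r j)) A = measure P (S r j -` A)" for j
    using assms by (subst measure_distr) auto
  moreover have "measure P A = 1 / 3 * (\<Sum>j\<in>{1,2,3}. measure (distr P borel (S r j)) A)"
    using self_similar assms unfolding self_similar_measure_def by blast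
  ultimately show ?thesis by simp
qed

text \<open>
  No support or moment condition on \<open>P\<close> is assumed. Since the maps contract by \<open>r\<close>, the mass
  outside the \<open>t\<close>-neighbourhood of \<open>[0, 1]\<close> is at most that outside the \<open>t / r\<close>-neighbourhood,
  so iterating shows that it vanishes.
\<close>

definition tail :: "real \<Rightarrow> real" where
  "tail t = measure P {x. 1 / 2 + t < \<bar>x - 1 / 2\<bar>}"

lemma tail_le_scaled: "tail t \<le> tail (t / r)"
proof -
  have "measure P (S r j -` {x. 1 / 2 + t < \<bar>x - 1 / 2\<bar>}) \<le> tail (t / r)" if "j \<in> {1,2,3}" for j
    unfolding tail_def
  proof (rule finite_measure_mono)
    show "{x. 1 / 2 + t / r < \<bar>x - 1 / 2\<bar>} \<in> sets P" by measurable
    show "S r j -` {x. 1 / 2 + t < \<bar>x - 1 / 2\<bar>} \<subseteq> {x. 1 / 2 + t / r < \<bar>x - 1 / 2\<bar>}"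
    proof
      fix x assume "x \<in> S r j -` {x. 1 / 2 + t < \<bar>x - 1 / 2\<bar>}"
      then have "1 / 2 + t < \<bar>S r j x - 1 / 2\<bar>" by simp
      \<comment> \<open>Centred at 1/2, the translations of the three maps become -1, 0, 1 times
        \<open>(1 - r) / 2\<close>.\<close>
      also have "S r j x - 1 / 2 = r * (x - 1 / 2) + (real j - 2) * ((1 - r) / 2)"
        by (simp add: S_def field_simps)
      also have "\<bar>\<dots>\<bar> \<le> r * \<bar>x - 1 / 2\<bar> + \<bar>real j - 2\<bar> * ((1 - r) / 2)"
        using r_pos r_less by (intro order_trans[OF abs_triangle_ineq]) (simp add: abs_mult)
      also have "\<bar>real j - 2\<bar> * ((1 - r) / 2) \<le> 1 * ((1 - r) / 2)"
        using that r_less by (intro mult_right_mono) auto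
      finally have "t < r * (\<bar>x - 1 / 2\<bar> - 1 / 2)" by (simp add: field_simps)
      then have "t / r < \<bar>x - 1 / 2\<bar> - 1 / 2" using r_pos by (simp add: field_simps)
      then show "x \<in> {x. 1 / 2 + t / r < \<bar>x - 1 / 2\<bar>}" by simp
    qed
  qed
  from this[of 1] this[of 2] this[of 3]
  show ?thesis using measure_self_similar[of "{x. 1 / 2 + t < \<bar>x - 1 / 2\<bar>}"]
    by (simp add: tail_def)
qed

lemma tail_eq_0:
  assumes "0 < t"
  shows "tail t = 0"
proof -
  define A where "A k = {x. 1 / 2 + t / r ^ k < \<bar>x - 1 / 2\<bar>}" for k
  have le: "tail t \<le> measure P (A k)" for k
  proof (induction k)
    case (Suc k)
    have "tail (t / r ^ k) \<le> tail (t / r ^ Suc k)"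
      using tail_le_scaled[of "t / r ^ k"] by (simp add: mult.commute)
    then show ?case using Suc by (simp add: tail_def A_def)
  qed (simp add: tail_def A_def)
  have "decseq A"
  proof (intro decseq_SucI subsetI)
    fix k x assume "x \<in> A (Suc k)"
    moreover have "t / r ^ k \<le> t / r ^ Suc k"
      using assms r_pos r_less
      by (intro divide_left_mono) (auto intro: mult_left_le_one_le)
    ultimately show "x \<in> A k" by (auto simp: A_def)
  qed
  moreover have "range A \<subseteq> sets P" unfolding A_def by (auto simp: sets_P)
  ultimately have "(\<lambda>k. measure P (A k)) \<longlonglongrightarrow> measure P (\<Inter>k. A k)"
    by (intro finite_Lim_measure_decseq) auto
  \<comment> \<open>The radii \<open>t / r ^ k\<close> tend to infinity, so every point eventually
    leaves the sets; by continuity from above their measures tend to 0.\<close>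
  moreover have "(\<Inter>k. A k) = {}"
  proof -
    have "\<exists>k. x \<notin> A k" for x
    proof -
      obtain k where k: "\<bar>x - 1 / 2\<bar> / t < (1 / r) ^ k"
        using real_arch_pow[of "1 / r"] r_pos r_less by auto
      then have "\<bar>x - 1 / 2\<bar> < t / r ^ k"
        using assms r_pos by (simp add: field_simps power_divide)
      then show ?thesis by (intro exI[of _ k]) (auto simp: A_def)
    qed
    then show ?thesis by blast
  qed
  ultimately have "(\<lambda>k. measure P (A k)) \<longlonglongrightarrow> 0" by simp
  then have "tail t \<le> 0" using le by (intro LIMSEQ_le_const) auto
  then show ?thesis by (simp add: tail_def measure_le_0_iff)
qed

text \<open>The tail beyond every positive \<open>t\<close> is null, and the countably many
  \<open>t = 1 / real (Suc k)\<close> cover the complement of the unit interval.\<close>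

lemma AE_unit: "AE x in P. 0 \<le> x \<and> x \<le> 1"
proof -
  have "AE x in P. \<not> 1 / 2 + 1 / real (Suc k) < \<bar>x - 1 / 2\<bar>" for k
  proof (rule AE_I[where N = "{x. 1 / 2 + 1 / real (Suc k) < \<bar>x - 1 / 2\<bar>}"])
    show "emeasure P {x. 1 / 2 + 1 / real (Suc k) < \<bar>x - 1 / 2\<bar>} = 0"
      using tail_eq_0[of "1 / real (Suc k)"] by (simp add: tail_def emeasure_eq_measure)
  qed auto
  then have "AE x in P. \<forall>k. \<not> 1 / 2 + 1 / real (Suc k) < \<bar>x - 1 / 2\<bar>"
    by (simp add: AE_all_countable)
  then show ?thesis
  proof (rule AE_mp, intro AE_I2 impI)
    fix x assume *: "\<forall>k. \<not> 1 / 2 + 1 / real (Suc k) < \<bar>x - 1 / 2\<bar>"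
    have "\<bar>x - 1 / 2\<bar> \<le> 1 / 2"
    proof (rule ccontr)
      assume "\<not> \<bar>x - 1 / 2\<bar> \<le> 1 / 2"
      then obtain k where "inverse (real (Suc k)) < \<bar>x - 1 / 2\<bar> - 1 / 2"
        using reals_Archimedean[of "\<bar>x - 1 / 2\<bar> - 1 / 2"] by auto
      then show False using *[rule_format, of k] by (simp add: inverse_eq_divide)
    qed
    then show "0 \<le> x \<and> x \<le> 1" unfolding abs_le_iff by linarith
  qed
qed

text \<open>The identity for measures of sets is carried through the standard construction of Borel
  functions; values in \<open>ennreal\<close> avoid integrability questions.\<close>

lemma nn_integral_self_similar:
  assumes "f \<in> borel_measurable borel"
  shows "3 * (\<integral>\<^sup>+ x. f x \<partial>P)
    = (\<integral>\<^sup>+ x. f (S r 1 x) \<partial>P) + (\<integral>\<^sup>+ x. f (S r 2 x) \<partial>P) + (\<integral>\<^sup>+ x. f (S r 3 x) \<partial>P)"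
  using assms
proof (induction rule: borel_measurable_induct)
  case (cong f g)
  then have "f = g" by auto
  then show ?case using cong by simp
next
  case (set A)
  have ind: "indicator A (S r j x) = (indicator (S r j -` A) x :: ennreal)" for j x
    by (simp add: indicator_def)
  have m: "S r j -` A \<in> sets P" for j
    using measurable_sets[OF S_measurable set(1)] by (simp add: sets_P)
  have int: "(\<integral>\<^sup>+ x. indicator (S r j -` A) x \<partial>P) = ennreal (measure P (S r j -` A))" for j
    by (subst nn_integral_indicator[OF m]) (rule emeasure_eq_measure)
  have "ennreal (3 * measure P A) = ennreal (measure P (S r 1 -` A) + measure P (S r 2 -` A)
      + measure P (S r 3 -` A))"
    using measure_self_similar set by simp
  then show ?case
    using set unfolding ind int
    by (simp add: sets_P emeasure_eq_measure ennreal_mult' ennreal_plus[symmetric] del: ennreal_plus)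
next
  case (mult u c)
  have [measurable]: "u \<in> borel_measurable borel" by fact
  have eq: "(\<integral>\<^sup>+ x. c * u (S r j x) \<partial>P) = c * (\<integral>\<^sup>+ x. u (S r j x) \<partial>P)" for j
    by (rule nn_integral_cmult) measurable
  have eq': "(\<integral>\<^sup>+ x. c * u x \<partial>P) = c * (\<integral>\<^sup>+ x. u x \<partial>P)"
    by (rule nn_integral_cmult) measurable
  show ?case
    using arg_cong[OF mult.IH, of "\<lambda>z. c * z"] unfolding eq eq' by (simp add: algebra_simps)
next
  case (add u w)
  have [measurable]: "u \<in> borel_measurable borel" "w \<in> borel_measurable borel" by fact+
  have eq: "(\<integral>\<^sup>+ x. w (S r j x) + u (S r j x) \<partial>P)
      = (\<integral>\<^sup>+ x. w (S r j x) \<partial>P) + (\<integral>\<^sup>+ x. u (S r j x) \<partial>P)" for j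
    by (rule nn_integral_add) measurable
  have eq': "(\<integral>\<^sup>+ x. w x + u x \<partial>P) = (\<integral>\<^sup>+ x. w x \<partial>P) + (\<integral>\<^sup>+ x. u x \<partial>P)"
    by (rule nn_integral_add) measurable
  show ?case unfolding eq eq' distrib_left add.IH by (simp add: ac_simps)
next
  case (seq U)
  have [measurable]: "U i \<in> borel_measurable borel" for i by fact
  have inc: "incseq (\<lambda>i x. U i (S r j x))" for j
    using seq by (auto simp: incseq_def le_fun_def)
  have eq: "(\<integral>\<^sup>+ x. (SUP i. U i) (S r j x) \<partial>P) = (SUP i. \<integral>\<^sup>+ x. U i (S r j x) \<partial>P)" for j
    unfolding SUP_apply by (rule nn_integral_monotone_convergence_SUP[OF inc]) measurable
  have eq': "(\<integral>\<^sup>+ x. (SUP i. U i) x \<partial>P) = (SUP i. \<integral>\<^sup>+ x. U i x \<partial>P)"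
    unfolding SUP_apply using seq by (intro nn_integral_monotone_convergence_SUP) auto
  \<comment> \<open>Monotonicity of the three sequences lets the supremum be split over their
    sum.\<close>
  have inc': "incseq (\<lambda>i. \<integral>\<^sup>+ x. U i (S r j x) \<partial>P)" for j
    using inc by (auto simp: incseq_def le_fun_def intro!: nn_integral_mono)
  have "3 * (SUP i. \<integral>\<^sup>+ x. U i x \<partial>P) = (SUP i. 3 * \<integral>\<^sup>+ x. U i x \<partial>P)"
    by (rule SUP_mult_left_ennreal)
  also have "\<dots> = (SUP i. (\<integral>\<^sup>+ x. U i (S r 1 x) \<partial>P) + (\<integral>\<^sup>+ x. U i (S r 2 x) \<partial>P)
      + (\<integral>\<^sup>+ x. U i (S r 3 x) \<partial>P))"
    by (simp only: seq.IH)
  also have "\<dots> = (SUP i. \<integral>\<^sup>+ x. U i (S r 1 x) \<partial>P) + (SUP i. \<integral>\<^sup>+ x. U i (S r 2 x) \<partial>P)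
      + (SUP i. \<integral>\<^sup>+ x. U i (S r 3 x) \<partial>P)"
    using inc' by (simp add: ennreal_SUP_add incseq_def add_mono)
  finally show ?case unfolding eq eq' .
qed

lemma S_unit:
  assumes "x \<in> {0..1}" "j \<in> {1,2,3}"
  shows "S r j x \<in> {0..1}"
proof -
  define y where "y = r * x"
  have "0 \<le> y" "y \<le> r"
    using assms(1) r_pos by (auto simp: y_def intro: mult_left_le)
  moreover have "S r j x = y \<or> S r j x = y + (1 - r) / 2 \<or> S r j x = y + (1 - r)"
    using assms(2) by (auto simp: S_def y_def)
  ultimately show ?thesis using r_less by (auto simp: field_simps)
qed

lemma integrable_bounded:
  fixes f :: "real \<Rightarrow> real"
  assumes [measurable]: "f \<in> borel_measurable borel" and "\<And>x. x \<in> {0..1} \<Longrightarrow> \<bar>f x\<bar> \<le> B"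
  shows "integrable P f"
proof (rule integrable_const_bound[where B = B])
  show "AE x in P. norm (f x) \<le> B"
    using AE_unit by eventually_elim (use assms in auto)
qed measurable

lemma integrable_bounded_S:
  fixes f :: "real \<Rightarrow> real"
  assumes [measurable]: "f \<in> borel_measurable borel" and "\<And>x. x \<in> {0..1} \<Longrightarrow> \<bar>f x\<bar> \<le> B"
    and "j \<in> {1,2,3}"
  shows "integrable P (\<lambda>x. f (S r j x))"
proof (rule integrable_bounded[where B = B])
  show "\<bar>f (S r j x)\<bar> \<le> B" if "x \<in> {0..1}" for x
    using assms(2)[OF S_unit[OF that assms(3)]] .
qed measurable

text \<open>Adding \<open>B\<close> makes the function nonnegative almost everywhere and reduces to
  \<open>nn_integral_self_similar\<close>; the constant then cancels. Measurability in place of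
  continuity admits indicators of cylinders, needed for \<open>a_mean\<close>.\<close>

lemma integral_self_similar_bounded:
  fixes f :: "real \<Rightarrow> real"
  assumes [measurable]: "f \<in> borel_measurable borel" and bd: "\<And>x. x \<in> {0..1} \<Longrightarrow> \<bar>f x\<bar> \<le> B"
  shows "3 * (LINT x|P. f x)
    = (LINT x|P. f (S r 1 x)) + (LINT x|P. f (S r 2 x)) + (LINT x|P. f (S r 3 x))"
proof -
  define g where "g x = f x + B" for x
  have [measurable]: "g \<in> borel_measurable borel" unfolding g_def by measurable
  have g0: "0 \<le> g x" if "x \<in> {0..1}" for x using bd[OF that] by (simp add: g_def)
  have i: "integrable P f" and ij: "j \<in> {1,2,3} \<Longrightarrow> integrable P (\<lambda>x. f (S r j x))" for j
    using integrable_bounded[OF assms] integrable_bounded_S[OF assms] by auto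
  have gj: "integral\<^sup>L P (\<lambda>x. g (S r j x)) = integral\<^sup>L P (\<lambda>x. f (S r j x)) + B"
    "(\<integral>\<^sup>+ x. ennreal (g (S r j x)) \<partial>P) = ennreal (LINT x|P. g (S r j x))"
    "0 \<le> integral\<^sup>L P (\<lambda>x. g (S r j x))"
    if j: "j \<in> {1,2,3}" for j
  proof -
    show "integral\<^sup>L P (\<lambda>x. g (S r j x)) = integral\<^sup>L P (\<lambda>x. f (S r j x)) + B"
      unfolding g_def using ij[OF j] by simp
    have ae: "AE x in P. 0 \<le> g (S r j x)"
      using AE_unit by eventually_elim (use g0 S_unit j in auto)
    then show "0 \<le> integral\<^sup>L P (\<lambda>x. g (S r j x))" by (rule integral_nonneg_AE)
    show "(\<integral>\<^sup>+ x. ennreal (g (S r j x)) \<partial>P) = ennreal (LINT x|P. g (S r j x))"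
      using ae ij[OF j] by (intro nn_integral_eq_integral) (auto simp: g_def)
  qed
  have ae: "AE x in P. 0 \<le> g x" using AE_unit by eventually_elim (use g0 in auto)
  have g: "integral\<^sup>L P g = integral\<^sup>L P f + B"
    unfolding g_def using i by simp
  have "(\<integral>\<^sup>+ x. ennreal (g x) \<partial>P) = ennreal (LINT x|P. g x)"
    using ae i by (intro nn_integral_eq_integral) (auto simp: g_def)
  moreover have "0 \<le> integral\<^sup>L P g" using ae by (rule integral_nonneg_AE)
  ultimately have "ennreal (3 * integral\<^sup>L P g) = ennreal ((LINT x|P. g (S r 1 x))
      + (LINT x|P. g (S r 2 x)) + (LINT x|P. g (S r 3 x)))"
    using nn_integral_self_similar[of "\<lambda>x. ennreal (g x)"] gj(2,3)
    by (simp add: ennreal_mult')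
  then have "3 * integral\<^sup>L P g = (LINT x|P. g (S r 1 x))
      + (LINT x|P. g (S r 2 x)) + (LINT x|P. g (S r 3 x))"
    using gj(3) \<open>0 \<le> integral\<^sup>L P g\<close> by (subst (asm) ennreal_inj) auto
  then show ?thesis using g gj(1) by simp
qed

lemma
  fixes f :: "real \<Rightarrow> real"
  assumes "continuous_on UNIV f"
  shows integrable_continuous: "integrable P f"
    and integral_self_similar: "3 * (LINT x|P. f x)
      = (LINT x|P. f (S r 1 x)) + (LINT x|P. f (S r 2 x)) + (LINT x|P. f (S r 3 x))"
proof -
  have m: "f \<in> borel_measurable borel" using assms by (rule borel_measurable_continuous_onI)
  obtain B where "\<forall>x\<in>{0..1}. \<bar>f x\<bar> \<le> B"
    using continuous_bounded_unit[OF assms] ..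
  then have B: "\<bar>f x\<bar> \<le> B" if "x \<in> {0..1}" for x using that by (rule bspec)
  show "integrable P f" using m B by (rule integrable_bounded)
  show "3 * (LINT x|P. f x)
      = (LINT x|P. f (S r 1 x)) + (LINT x|P. f (S r 2 x)) + (LINT x|P. f (S r 3 x))"
    using m B by (rule integral_self_similar_bounded)
qed

section \<open>Mean and variance of P\<close>

lemma mean: "(LINT x|P. x) = 1 / 2"
proof -
  have i: "integrable P (\<lambda>x. x)" by (rule integrable_continuous) auto
  have "3 * (LINT x|P. x) = (LINT x|P. S r 1 x) + (LINT x|P. S r 2 x) + (LINT x|P. S r 3 x)"
    by (rule integral_self_similar) auto
  also have "\<dots> = 3 * r * (LINT x|P. x) + 3 * (1 - r) / 2"
    unfolding S_alt using i by (simp add: field_simps)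
  finally have "(1 - r) * ((LINT x|P. x) - 1 / 2) = 0" by (simp add: field_simps)
  then show ?thesis using r_less by simp
qed

definition V :: real where "V = variance (\<lambda>x. x)"

text \<open>Variance plus squared bias. The case \<open>c = 1\<close> treats P itself,
  \<open>c = r\<close> its image on a level-one cylinder.\<close>

lemma integral_square_dist: "(LINT x|P. (c * x + t)\<^sup>2) = c\<^sup>2 * V + (c / 2 + t)\<^sup>2"
proof -
  have i: "integrable P (\<lambda>x. x)" "integrable P (\<lambda>x. x\<^sup>2)"
    by (rule integrable_continuous, intro continuous_intros)+
  have "(LINT x|P. (c * x + t)\<^sup>2) = c\<^sup>2 * (LINT x|P. x\<^sup>2) + c * t + t\<^sup>2"
    using i mean by (simp add: power2_sum power_mult_distrib mult_ac)
  moreover have "(LINT x|P. x\<^sup>2) = V + 1 / 4"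
    unfolding V_def by (subst variance_eq[OF i]) (simp add: mean power2_eq_square)
  ultimately show ?thesis by (simp add: power2_sum power_divide algebra_simps)
qed

lemma integral_square_dist_point: "(LINT x|P. (x - a)\<^sup>2) = V + (1 / 2 - a)\<^sup>2"
  using integral_square_dist[of 1 "- a"] by simp

lemma integral_square_dist_S:
  "(LINT x|P. (S r j x - a)\<^sup>2) = r\<^sup>2 * V + (S r j (1 / 2) - a)\<^sup>2"
  using integral_square_dist[of r "(real j - 1) / 2 * (1 - r) - a"]
  by (simp add: S_def algebra_simps)

lemma V_eq: "V = (1 - r) / (6 * (1 + r))"
proof -
  have "3 * (LINT x|P. (x - 1 / 2)\<^sup>2) = (LINT x|P. (S r 1 x - 1 / 2)\<^sup>2)
      + (LINT x|P. (S r 2 x - 1 / 2)\<^sup>2) + (LINT x|P. (S r 3 x - 1 / 2)\<^sup>2)"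
    by (rule integral_self_similar) (intro continuous_intros)
  \<comment> \<open>One cylinder centre equals 1/2 and two lie at distance
    \<open>(1 - r) / 2\<close> from it, so self-similarity gives a linear equation for
    \<open>V\<close>.\<close>
  then have "3 * V = 3 * r\<^sup>2 * V + (1 - r)\<^sup>2 / 2"
    unfolding integral_square_dist_S integral_square_dist_point unfolding S_alt
    by (simp add: power2_eq_square field_simps)
  then have "(1 - r) * (6 * (1 + r) * V - (1 - r)) = 0"
    by (simp add: power2_eq_square field_simps)
  then have "6 * (1 + r) * V = 1 - r" using r_less by simp
  then show ?thesis using r_pos by (simp add: field_simps)
qed

end

subsection \<open>Distortion on level-one cylinders\<close>

context self_similar
begin

lemma integral_mono_unit:
  fixes f g :: "real \<Rightarrow> real"
  assumes "continuous_on UNIV f" "continuous_on UNIV g" "\<And>x. x \<in> {0..1} \<Longrightarrow> f x \<le> g x"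
  shows "(LINT x|P. f x) \<le> (LINT x|P. g x)"
proof (rule integral_mono_AE)
  show "AE x in P. f x \<le> g x" using AE_unit by eventually_elim (use assms(3) in auto)
qed (use integrable_continuous assms in auto)

end

section \<open>Nearest-point distance and the share of a single cylinder\<close>

definition min_sq_dist :: "real set \<Rightarrow> real \<Rightarrow> real" where
  "min_sq_dist \<alpha> x = Min ((\<lambda>a. (x - a)\<^sup>2) ` \<alpha>)"

lemma distortion_min_sq_dist: "distortion P \<alpha> = (LINT x|P. min_sq_dist \<alpha> x)"
  by (simp add: distortion_def min_sq_dist_def)

lemma min_sq_dist_le: "finite \<alpha> \<Longrightarrow> a \<in> \<alpha> \<Longrightarrow> min_sq_dist \<alpha> x \<le> (x - a)\<^sup>2"
  by (simp add: min_sq_dist_def)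

lemma min_sq_dist_attained:
  assumes "finite \<alpha>" "\<alpha> \<noteq> {}"
  obtains a where "a \<in> \<alpha>" "min_sq_dist \<alpha> x = (x - a)\<^sup>2" "\<And>b. b \<in> \<alpha> \<Longrightarrow> \<bar>x - a\<bar> \<le> \<bar>x - b\<bar>"
proof -
  have "min_sq_dist \<alpha> x \<in> (\<lambda>a. (x - a)\<^sup>2) ` \<alpha>"
    unfolding min_sq_dist_def using assms by (intro Min_in) auto
  then obtain a where a: "a \<in> \<alpha>" "min_sq_dist \<alpha> x = (x - a)\<^sup>2" by auto
  have "\<bar>x - a\<bar> \<le> \<bar>x - b\<bar>" if "b \<in> \<alpha>" for b
    using min_sq_dist_le[OF assms(1) that, of x] a(2) by (simp add: abs_le_square_iff)
  with a show thesis by (rule that)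
qed

lemma continuous_min_sq_dist:
  assumes "finite \<alpha>" "\<alpha> \<noteq> {}"
  shows "continuous_on A (min_sq_dist \<alpha>)"
  using assms
proof (induction \<alpha> rule: finite_ne_induct)
  case (singleton a)
  show ?case unfolding min_sq_dist_def by (auto intro!: continuous_intros)
next
  case (insert a \<alpha>)
  have "min_sq_dist (insert a \<alpha>) = (\<lambda>x. min ((x - a)\<^sup>2) (min_sq_dist \<alpha> x))"
    using insert by (simp add: min_sq_dist_def fun_eq_iff)
  then show ?case using insert.IH by (auto intro!: continuous_intros continuous_on_min)
qed

lemma continuous_S: "continuous_on A (S r j)"
  unfolding S_def[abs_def] by (intro continuous_intros)

lemma continuous_min_sq_dist_S:
  assumes "finite \<alpha>" "\<alpha> \<noteq> {}"
  shows "continuous_on UNIV (\<lambda>x. min_sq_dist \<alpha> (S r j x))"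
  using continuous_on_compose2[OF continuous_min_sq_dist[OF assms] continuous_S] by blast

text \<open>The integral against the image of P under \<open>S r j\<close>. The mass 1/3 of the
  cylinder is left out and reappears as the factor 3 in \<open>distortion_cells\<close>.\<close>

definition cell_distortion :: "real measure \<Rightarrow> real \<Rightarrow> real set \<Rightarrow> nat \<Rightarrow> real" where
  "cell_distortion P r \<alpha> j = (LINT x|P. min_sq_dist \<alpha> (S r j x))"

context self_similar
begin

lemma distortion_cells:
  assumes "finite \<alpha>" "\<alpha> \<noteq> {}"
  shows "3 * distortion P \<alpha>
    = cell_distortion P r \<alpha> 1 + cell_distortion P r \<alpha> 2 + cell_distortion P r \<alpha> 3"
  unfolding distortion_min_sq_dist cell_distortion_def
  by (rule integral_self_similar[OF continuous_min_sq_dist[OF assms]])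

lemma cell_distortion_le:
  assumes "finite \<alpha>" "a \<in> \<alpha>"
  shows "cell_distortion P r \<alpha> j \<le> r\<^sup>2 * V + (S r j (1 / 2) - a)\<^sup>2"
  unfolding cell_distortion_def integral_square_dist_S[symmetric] using assms
  by (intro integral_mono_unit continuous_min_sq_dist_S min_sq_dist_le)
    (auto simp: S_def intro!: continuous_intros)

lemma cell_distortion_ge_nearest:
  assumes "finite \<alpha>" "a \<in> \<alpha>" "\<And>x b. x \<in> {0..1} \<Longrightarrow> b \<in> \<alpha> \<Longrightarrow> \<bar>S r j x - a\<bar> \<le> \<bar>S r j x - b\<bar>"
  shows "r\<^sup>2 * V + (S r j (1 / 2) - a)\<^sup>2 \<le> cell_distortion P r \<alpha> j"
  unfolding cell_distortion_def integral_square_dist_S[symmetric]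
proof (rule integral_mono_unit)
  show "continuous_on UNIV (\<lambda>x. (S r j x - a)\<^sup>2)"
    by (auto simp: S_def intro!: continuous_intros)
  show "continuous_on UNIV (\<lambda>x. min_sq_dist \<alpha> (S r j x))"
    using assms by (intro continuous_min_sq_dist_S) auto
  fix x :: real assume "x \<in> {0..1}"
  then show "(S r j x - a)\<^sup>2 \<le> min_sq_dist \<alpha> (S r j x)"
    using assms min_sq_dist_attained[of \<alpha> "S r j x"] by (metis abs_le_square_iff empty_iff)
qed

lemma cell_distortion_ge_dist:
  assumes "finite \<alpha>" "\<alpha> \<noteq> {}" "0 \<le> \<delta>"
    and "\<And>x b. x \<in> {0..1} \<Longrightarrow> b \<in> \<alpha> \<Longrightarrow> \<delta> \<le> \<bar>S r j x - b\<bar>"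
  shows "\<delta>\<^sup>2 \<le> cell_distortion P r \<alpha> j"
proof -
  have "(LINT x|P. \<delta>\<^sup>2) \<le> (LINT x|P. min_sq_dist \<alpha> (S r j x))"
  proof (rule integral_mono_unit)
    show "continuous_on UNIV (\<lambda>x. min_sq_dist \<alpha> (S r j x))"
      using assms by (intro continuous_min_sq_dist_S) auto
    fix x :: real assume x: "x \<in> {0..1}"
    obtain a where "a \<in> \<alpha>" "min_sq_dist \<alpha> (S r j x) = (S r j x - a)\<^sup>2"
      using min_sq_dist_attained[OF assms(1,2)] by metis
    then show "\<delta>\<^sup>2 \<le> min_sq_dist \<alpha> (S r j x)"
      using assms(3) assms(4)[OF x, of a] by (simp add: abs_le_square_iff[symmetric])
  qed auto
  then show ?thesis by (simp add: cell_distortion_def)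
qed

text \<open>Only points of \<alpha> nearest to some point of the cylinder matter; they lie in the
  image of \<gamma>, and \<open>S r j\<close> scales distances by \<open>r\<close>. In the induction
  \<gamma> has fewer points than \<alpha>.\<close>

lemma cell_distortion_ge_scaled:
  assumes "finite \<alpha>" "\<alpha> \<noteq> {}" "finite \<gamma>" "\<gamma> \<noteq> {}"
    and "\<And>x a. x \<in> {0..1} \<Longrightarrow> a \<in> \<alpha> \<Longrightarrow> (\<And>b. b \<in> \<alpha> \<Longrightarrow> \<bar>S r j x - a\<bar> \<le> \<bar>S r j x - b\<bar>) \<Longrightarrow> a \<in> S r j ` \<gamma>"
  shows "r\<^sup>2 * distortion P \<gamma> \<le> cell_distortion P r \<alpha> j"
proof -
  have "(LINT x|P. r\<^sup>2 * min_sq_dist \<gamma> x) \<le> (LINT x|P. min_sq_dist \<alpha> (S r j x))"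
  proof (rule integral_mono_unit)
    show "continuous_on UNIV (\<lambda>x. min_sq_dist \<alpha> (S r j x))"
      using assms by (intro continuous_min_sq_dist_S) auto
    show "continuous_on UNIV (\<lambda>x. r\<^sup>2 * min_sq_dist \<gamma> x)"
      using assms by (intro continuous_intros continuous_min_sq_dist) auto
    fix x :: real assume x: "x \<in> {0..1}"
    obtain a where a: "a \<in> \<alpha>" "min_sq_dist \<alpha> (S r j x) = (S r j x - a)\<^sup>2"
      "\<And>b. b \<in> \<alpha> \<Longrightarrow> \<bar>S r j x - a\<bar> \<le> \<bar>S r j x - b\<bar>"
      using min_sq_dist_attained[OF assms(1,2)] by metis
    then obtain c where c: "c \<in> \<gamma>" "a = S r j c" using assms(5)[OF x] by blast
    have "S r j x - S r j c = r * (x - c)" by (simp add: S_def algebra_simps)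
    then show "r\<^sup>2 * min_sq_dist \<gamma> x \<le> min_sq_dist \<alpha> (S r j x)"
      using min_sq_dist_le[OF assms(3) c(1), of x] a(2) c(2)
      by (simp add: power_mult_distrib mult_left_mono)
  qed
  then show ?thesis by (simp add: cell_distortion_def distortion_min_sq_dist)
qed

lemma distortion_singleton: "distortion P {a} = V + (1 / 2 - a)\<^sup>2"
  by (simp add: distortion_def integral_square_dist_point)

text \<open>\<open>(1 - r)\<^sup>2 / 8 = V - V(P;\<beta>\<^sub>2)\<close> and \<open>(1 - r)\<^sup>2 / 24 = V(P;\<beta>\<^sub>2) - V(P;\<beta>\<^sub>3)\<close>.\<close>

sublocale gap_sequence "r\<^sup>2 / 3" V "(1 - r)\<^sup>2 / 8" "(1 - r)\<^sup>2 / 24"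
proof
  show "V - (1 - r)\<^sup>2 / 8 - (1 - r)\<^sup>2 / 24 = 3 * (r\<^sup>2 / 3) * V"
    unfolding V_eq using r_pos by (simp add: field_simps power2_eq_square)
  have "r\<^sup>2 \<le> 1" using r_pos r_less by (simp add: power_le_one)
  then show "r\<^sup>2 / 3 * ((1 - r)\<^sup>2 / 8) \<le> (1 - r)\<^sup>2 / 24"
    using mult_right_mono[of "r\<^sup>2" 1 "(1 - r)\<^sup>2"] by simp
qed auto

end

subsection \<open>The lower bound\<close>

text \<open>The preceding theory covers all \<open>r < 1 / 3\<close>. The value 1/25 enters through
  numerical margins, for two means and for a cylinder far from all points.\<close>

locale self_similar_25 = self_similar +
  assumes r_eq: "r = 1 / 25"
begin

lemma V_25: "V = 2 / 13"
  by (simp add: V_eq r_eq)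

lemma S_25_mid: "S r 1 (1 / 2) = 1 / 50" "S r 2 (1 / 2) = 1 / 2" "S r 3 (1 / 2) = 49 / 50"
  by (simp_all add: S_def r_eq)

lemma S_25_bounds:
  assumes "x \<in> {0..1}"
  shows "S r 1 x \<in> {0..1 / 25}" "S r 2 x \<in> {12 / 25..13 / 25}" "S r 3 x \<in> {24 / 25..1}"
  using assms by (auto simp: S_def r_eq field_simps)

text \<open>A cylinder on one side of the midpoint \<open>m\<close> costs its inner variance
  \<open>r\<^sup>2 * V\<close> plus the squared distance from its centre to the point serving it,
  and two neighbours sharing a point cost at least 72/625 beyond inner variance. The bound
  \<open>3 * err 2\<close> consists of three inner variances and one such pair. Cases 5 to 7 mirror
  cases 3 to 1.\<close>

lemma err_2_le_distortion_pair:
  assumes "a \<le> b"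
  shows "err 2 \<le> distortion P {a, b}"
proof -
  define m where "m = (a + b) / 2"
  define e where "e = cell_distortion P r {a, b}"
  have m2: "2 * m = a + b" by (simp add: m_def)
  have nl: "\<bar>y - a\<bar> \<le> \<bar>y - b\<bar>" if "y \<le> m" for y using assms m2 that by linarith
  have nr: "\<bar>y - b\<bar> \<le> \<bar>y - a\<bar>" if "m \<le> y" for y using assms m2 that by linarith
  have left: "r\<^sup>2 * V + (S r j (1 / 2) - a)\<^sup>2 \<le> e j" if "\<And>x. x \<in> {0..1} \<Longrightarrow> S r j x \<le> m" for j
    unfolding e_def using nl that by (intro cell_distortion_ge_nearest) auto
  have right: "r\<^sup>2 * V + (S r j (1 / 2) - b)\<^sup>2 \<le> e j" if "\<And>x. x \<in> {0..1} \<Longrightarrow> m \<le> S r j x" for j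
    unfolding e_def using nr that by (intro cell_distortion_ge_nearest) auto
  have far: "\<delta>\<^sup>2 \<le> e j"
    if "0 \<le> \<delta>" "\<And>x. x \<in> {0..1} \<Longrightarrow> \<delta> \<le> \<bar>S r j x - a\<bar> \<and> \<delta> \<le> \<bar>S r j x - b\<bar>" for j \<delta>
    unfolding e_def using that by (intro cell_distortion_ge_dist) auto
  have rV: "r\<^sup>2 * V = 2 / 8125" by (simp add: r_eq V_25 power2_eq_square)
  have nonneg: "0 \<le> e j" for j
    using far[of 0 j] by simp
  note left1 = left[of 1] and left2 = left[of 2] and left3 = left[of 3]
  note right1 = right[of 1] and right2 = right[of 2] and right3 = right[of 3]
  \<comment> \<open>13/50 and 37/50 are the midpoints between neighbouring cylinder centres; 72/625
    is half the squared distance of these centres.\<close>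
  have pair: "(1 / 50 - c)\<^sup>2 + (1 / 2 - c)\<^sup>2 = 2 * (c - 13 / 50)\<^sup>2 + 72 / 625"
    "(1 / 2 - c)\<^sup>2 + (49 / 50 - c)\<^sup>2 = 2 * (c - 37 / 50)\<^sup>2 + 72 / 625" for c :: real
    by (simp_all add: power2_eq_square algebra_simps)
  have sq: "0 \<le> (c - d)\<^sup>2" for c d :: real by simp
  have near: "(1 / 50)\<^sup>2 \<le> (c - d)\<^sup>2" if "1 / 50 \<le> \<bar>c - d\<bar>" for c d :: real
    using that by (simp add: abs_le_square_iff[symmetric])
  have "6 / 8125 + 72 / 625 \<le> e 1 + e 2 + e 3"
  proof -
    \<comment> \<open>The breakpoints are the endpoints of the cylinders; in cases 2, 4 and 6 a
      cylinder may be cut by \<open>m\<close>.\<close>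
    consider "m \<le> 0" | "0 \<le> m" "m \<le> 1 / 25" | "1 / 25 \<le> m" "m \<le> 12 / 25"
      | "12 / 25 \<le> m" "m \<le> 13 / 25" | "13 / 25 \<le> m" "m \<le> 24 / 25"
      | "24 / 25 \<le> m" "m \<le> 1" | "1 \<le> m"
      by linarith
    then show ?thesis
    proof cases
      case 1
      have "2 / 8125 + (1 / 50 - b)\<^sup>2 \<le> e 1" "2 / 8125 + (1 / 2 - b)\<^sup>2 \<le> e 2"
        "2 / 8125 + (49 / 50 - b)\<^sup>2 \<le> e 3"
        using right1 right2 right3 S_25_bounds 1 unfolding S_25_mid rV by force+
      then show ?thesis using pair(2)[of b] sq[of b "37 / 50"] sq[of "1 / 50" b] by linarith
    next
      case 2
      have e: "2 / 8125 + (1 / 2 - b)\<^sup>2 \<le> e 2" "2 / 8125 + (49 / 50 - b)\<^sup>2 \<le> e 3"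
        using right2 right3 S_25_bounds 2 unfolding S_25_mid rV by force+
      \<comment> \<open>If \<open>b\<close> is close to its ideal place 37/50, then
        \<open>a = 2 * m - b\<close> lies far to the left and the first cylinder is far from both
        points. Otherwise the deviation of \<open>b\<close> gains at least
        \<open>2 * (1 / 50)\<^sup>2\<close>, more than the missing inner variance 2/8125.\<close>
      show ?thesis
      proof (cases "\<bar>b - 37 / 50\<bar> \<le> 1 / 50")
        case True
        then have "18 / 25 \<le> b" "a \<le> - 16 / 25" using 2 m2 by linarith+
        then have "(3 / 5)\<^sup>2 \<le> e 1"
          using S_25_bounds(1) by (intro far) force+
        then have "9 / 25 \<le> e 1" by (simp add: power2_eq_square)
        then show ?thesis using e pair(2)[of b] sq[of b "37 / 50"] by linarith
      next
        case False
        then show ?thesis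
          using e pair(2)[of b] near[of b "37 / 50"] nonneg[of 1] by (simp add: power2_eq_square)
      qed
    next
      case 3
      have "2 / 8125 + (1 / 50 - a)\<^sup>2 \<le> e 1" "2 / 8125 + (1 / 2 - b)\<^sup>2 \<le> e 2"
        "2 / 8125 + (49 / 50 - b)\<^sup>2 \<le> e 3"
        using left1 right2 right3 S_25_bounds 3 unfolding S_25_mid rV by force+
      then show ?thesis using pair(2)[of b] sq[of b "37 / 50"] sq[of "1 / 50" a] by linarith
    next
      case 4
      define w where "w = (b - a) / 2"
      \<comment> \<open>The middle cylinder has length 1/25 and contains \<open>m\<close>, so it
        keeps distance \<delta> from both points, which lie at distance \<open>w\<close> from
        \<open>m\<close>.\<close>
      define \<delta> where "\<delta> = max 0 (w - 1 / 25)"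
      have a: "a = m - w" and b: "b = m + w" by (simp_all add: m_def w_def field_simps)
      have e: "2 / 8125 + (1 / 50 - a)\<^sup>2 \<le> e 1" "2 / 8125 + (49 / 50 - b)\<^sup>2 \<le> e 3"
        using left1 right3 S_25_bounds 4 unfolding S_25_mid rV by force+
      have "\<delta>\<^sup>2 \<le> e 2"
      proof (rule far)
        fix x :: real assume "x \<in> {0..1}"
        from S_25_bounds(2)[OF this] 4
        show "\<delta> \<le> \<bar>S r 2 x - a\<bar> \<and> \<delta> \<le> \<bar>S r 2 x - b\<bar>"
          unfolding \<delta>_def a b by auto
      qed (simp add: \<delta>_def)
      moreover have "(1 / 50 - a)\<^sup>2 + (49 / 50 - b)\<^sup>2 = 2 * (m - 1 / 2)\<^sup>2 + 2 * (w - 12 / 25)\<^sup>2"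
        unfolding a b by (simp add: power2_eq_square algebra_simps)
      \<comment> \<open>3/25 exceeds 72/625 + 2/8125, which makes up for the inner variance of the
        middle cylinder.\<close>
      moreover have "3 / 25 \<le> 2 * (w - 12 / 25)\<^sup>2 + \<delta>\<^sup>2"
      proof (cases "w \<le> 1 / 25")
        case True
        then have "(11 / 25)\<^sup>2 \<le> (w - 12 / 25)\<^sup>2"
          by (simp add: abs_le_square_iff[symmetric])
        then have "121 / 625 \<le> (w - 12 / 25)\<^sup>2" by (simp add: power2_eq_square)
        then show ?thesis using zero_le_power2[of \<delta>] by linarith
      next
        case False
        \<comment> \<open>The minimiser 1/3 is the mean of 12/25 and 1/25 with weights 2 and
          1.\<close>
        then have "2 * (w - 12 / 25)\<^sup>2 + \<delta>\<^sup>2 = 3 * (w - 1 / 3)\<^sup>2 + (289 / 625 - 1 / 3)"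
          by (simp add: \<delta>_def power2_eq_square algebra_simps)
        then show ?thesis using sq[of w "1 / 3"] by linarith
      qed
      ultimately show ?thesis using e sq[of m "1 / 2"] by linarith
    next
      case 5
      have "2 / 8125 + (1 / 50 - a)\<^sup>2 \<le> e 1" "2 / 8125 + (1 / 2 - a)\<^sup>2 \<le> e 2"
        "2 / 8125 + (49 / 50 - b)\<^sup>2 \<le> e 3"
        using left1 left2 right3 S_25_bounds 5 unfolding S_25_mid rV by force+
      then show ?thesis using pair(1)[of a] sq[of a "13 / 50"] sq[of "49 / 50" b] by linarith
    next
      case 6
      have e: "2 / 8125 + (1 / 50 - a)\<^sup>2 \<le> e 1" "2 / 8125 + (1 / 2 - a)\<^sup>2 \<le> e 2"
        using left1 left2 S_25_bounds 6 unfolding S_25_mid rV by force+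
      show ?thesis
      proof (cases "\<bar>a - 13 / 50\<bar> \<le> 1 / 50")
        case True
        then have "a \<le> 7 / 25" "41 / 25 \<le> b" using 6 m2 by linarith+
        then have "(3 / 5)\<^sup>2 \<le> e 3"
          using S_25_bounds(3) by (intro far) force+
        then have "9 / 25 \<le> e 3" by (simp add: power2_eq_square)
        then show ?thesis using e pair(1)[of a] sq[of a "13 / 50"] by linarith
      next
        case False
        then show ?thesis
          using e pair(1)[of a] near[of a "13 / 50"] nonneg[of 3] by (simp add: power2_eq_square)
      qed
    next
      case 7
      have "2 / 8125 + (1 / 50 - a)\<^sup>2 \<le> e 1" "2 / 8125 + (1 / 2 - a)\<^sup>2 \<le> e 2"
        "2 / 8125 + (49 / 50 - a)\<^sup>2 \<le> e 3"
        using left1 left2 left3 S_25_bounds 7 unfolding S_25_mid rV by force+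
      then show ?thesis using pair(1)[of a] sq[of a "13 / 50"] sq[of "49 / 50" a] by linarith
    qed
  qed
  moreover have "3 * err 2 = 6 / 8125 + 72 / 625"
    unfolding err_2 unfolding V_25 r_eq by (simp add: power2_eq_square)
  ultimately show ?thesis
    using distortion_cells[of "{a, b}"] unfolding e_def by simp
qed

text \<open>11/50 is half the gap between cylinders in \<open>S_gap\<close>. A cylinder has length
  1/25, so all of it stays 9/50 away from \<alpha>, and a third of \<open>(9 / 50)\<^sup>2\<close>
  already exceeds \<open>err 3 = 2 / 8125\<close>.\<close>

lemma distortion_ge_far_point:
  assumes "finite \<alpha>" "\<alpha> \<noteq> {}" "j \<in> {1,2,3}" "x \<in> {0..1}" "\<And>b. b \<in> \<alpha> \<Longrightarrow> 11 / 50 \<le> \<bar>S r j x - b\<bar>"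
  shows "err 3 < distortion P \<alpha>"
proof -
  have nonneg: "0 \<le> cell_distortion P r \<alpha> i" for i
    using cell_distortion_ge_dist[OF assms(1,2), of 0 i] by simp
  have "(9 / 50)\<^sup>2 \<le> cell_distortion P r \<alpha> j"
  proof (rule cell_distortion_ge_dist[OF assms(1,2)])
    fix y b :: real assume y: "y \<in> {0..1}" and b: "b \<in> \<alpha>"
    have "S r j y - S r j x = r * (y - x)" by (simp add: S_def algebra_simps)
    also have "\<bar>\<dots>\<bar> \<le> 1 / 25" using y assms(4) by (auto simp: r_eq abs_le_iff)
    finally show "9 / 50 \<le> \<bar>S r j y - b\<bar>" using assms(5)[OF b] by linarith
  qed simp
  then have "(9 / 50)\<^sup>2 \<le> 3 * distortion P \<alpha>"
    using distortion_cells[OF assms(1,2)] nonneg[of 1] nonneg[of 2] nonneg[of 3] assms(3) by auto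
  moreover have "err 3 = 2 / 8125" unfolding err_3 unfolding V_25 r_eq by (simp add: power2_eq_square)
  ultimately show ?thesis by (simp add: power2_eq_square)
qed

lemma S_gap:
  assumes "x \<in> {0..1}" "y \<in> {0..1}" "i \<in> {1,2,3}" "j \<in> {1,2,3}" "i \<noteq> j"
  shows "11 / 25 \<le> \<bar>S r i x - S r j y\<bar>"
  using S_25_bounds[OF assms(1)] S_25_bounds[OF assms(2)] assms(3-5) by auto

lemma err_le_distortion:
  assumes "finite \<alpha>" "\<alpha> \<noteq> {}"
  shows "err (card \<alpha>) \<le> distortion P \<alpha>"
  using assms
proof (induction "card \<alpha>" arbitrary: \<alpha> rule: less_induct)
  case (less \<alpha>)
  have "card \<alpha> \<noteq> 0" using less.prems by simp
  then consider "card \<alpha> = 1" | "card \<alpha> = 2" | "3 \<le> card \<alpha>" by linarith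
  then show ?case
  proof cases
    case 1
    then obtain a where "\<alpha> = {a}" by (auto simp: card_1_singleton_iff)
    then show ?thesis by (simp add: distortion_singleton)
  next
    case 2
    then obtain a b where "\<alpha> = {a, b}" by (auto simp: card_2_iff)
    then have "err 2 \<le> distortion P \<alpha>"
      using err_2_le_distortion_pair[of a b] err_2_le_distortion_pair[of b a]
      by (cases "a \<le> b") (auto simp: insert_commute)
    then show ?thesis unfolding 2 .
  next
    case 3
    define near where "near j a x \<longleftrightarrow> (\<forall>b\<in>\<alpha>. \<bar>S r j x - a\<bar> \<le> \<bar>S r j x - b\<bar>)" for j a x
    \<comment> \<open>\<open>C j\<close> collects the points of \<alpha> serving cylinder
      \<open>j\<close>; \<open>T j\<close> inverts \<open>S r j\<close> and brings them back to unit
      scale.\<close>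
    define C where "C j = {a \<in> \<alpha>. \<exists>x\<in>{0..1}. near j a x}" for j
    define T where "T j a = (a - S r j 0) / r" for j a
    have ST: "S r j (T j a) = a" for j a using r_pos by (simp add: T_def S_def field_simps)
    have T_inj: "inj_on (T j) A" for j A using ST by (metis inj_onI)
    have C_sub: "C j \<subseteq> \<alpha>" and fin: "finite (C j)" for j
      using less.prems(1) by (auto simp: C_def)
    have C_ne: "C j \<noteq> {}" for j
    proof -
      obtain a where "a \<in> \<alpha>" "near j a 0"
        using min_sq_dist_attained[OF less.prems, of "S r j 0"] unfolding near_def by metis
      then have "a \<in> C j" by (auto simp: C_def)
      then show ?thesis by blast
    qed
    show ?thesis
    proof (cases "\<exists>i\<in>{1,2,3}. \<exists>j\<in>{1,2,3}. i \<noteq> j \<and> C i \<inter> C j \<noteq> {}")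
      case True
      then obtain i j a x y where *: "i \<in> {1,2,3}" "j \<in> {1,2,3}" "i \<noteq> j" "x \<in> {0..1}" "y \<in> {0..1}"
        "near i a x" "near j a y"
        unfolding C_def by blast
      \<comment> \<open>A shared point cannot be within half the gap of both cylinders. As it is
        nearest, all of \<alpha> is then at least as far away.\<close>
      have "11 / 50 \<le> \<bar>S r i x - a\<bar> \<or> 11 / 50 \<le> \<bar>S r j y - a\<bar>"
        using S_gap[OF *(4,5,1,2,3)] by linarith
      then have "err 3 < distortion P \<alpha>"
      proof
        assume "11 / 50 \<le> \<bar>S r i x - a\<bar>"
        with *(6) show ?thesis
          by (intro distortion_ge_far_point[OF less.prems *(1,4)]) (auto simp: near_def)
      next
        assume "11 / 50 \<le> \<bar>S r j y - a\<bar>"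
        with *(7) show ?thesis
          by (intro distortion_ge_far_point[OF less.prems *(2,5)]) (auto simp: near_def)
      qed
      then show ?thesis using err_antimono[of 3 "card \<alpha>"] 3 by simp
    next
      case False
      then have disj: "C 1 \<inter> C 2 = {}" "C 1 \<inter> C 3 = {}" "C 2 \<inter> C 3 = {}" by auto
      have "card (C 1 \<union> C 2 \<union> C 3) = card (C 1) + card (C 2) + card (C 3)"
        using disj fin by (simp add: card_Un_disjoint Int_Un_distrib2)
      then have sum_le: "card (C 1) + card (C 2) + card (C 3) \<le> card \<alpha>"
        using C_sub less.prems(1) by (metis card_mono Un_subset_iff)
      have pos: "1 \<le> card (C j)" for j
        using C_ne[of j] fin[of j] by (simp add: Suc_le_eq card_gt_0_iff)
      \<comment> \<open>The strict inequality opens the induction hypothesis; it holds below because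
        the other two parts are nonempty.\<close>
      have lower: "r\<^sup>2 * err (card (C j)) \<le> cell_distortion P r \<alpha> j" if "card (C j) < card \<alpha>" for j
      proof -
        have "r\<^sup>2 * err (card (T j ` C j)) \<le> r\<^sup>2 * distortion P (T j ` C j)"
          using that C_ne fin card_image[OF T_inj, of j "C j"]
          by (intro mult_left_mono less.hyps) auto
        also have "\<dots> \<le> cell_distortion P r \<alpha> j"
        proof (rule cell_distortion_ge_scaled)
          fix x a assume "x \<in> {0..1}" "a \<in> \<alpha>" "\<And>b. b \<in> \<alpha> \<Longrightarrow> \<bar>S r j x - a\<bar> \<le> \<bar>S r j x - b\<bar>"
          then have "a \<in> C j" unfolding C_def near_def by blast
          then show "a \<in> S r j ` T j ` C j" using ST[of j a] by (metis imageI)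
        qed (use C_ne fin less.prems in auto)
        finally show ?thesis using card_image[OF T_inj, of j "C j"] by simp
      qed
      \<comment> \<open>Points of \<alpha> that serve no cylinder are discarded here.\<close>
      have "err (card \<alpha>) \<le> err (card (C 1) + card (C 2) + card (C 3))"
        using sum_le pos[of 1] by (intro err_antimono) auto
      also have "\<dots> \<le> r\<^sup>2 / 3 * (err (card (C 1)) + err (card (C 2)) + err (card (C 3)))"
        by (intro err_split_le pos)
      also have "\<dots> \<le> distortion P \<alpha>"
        using lower[of 1] lower[of 2] lower[of 3] sum_le pos[of 1] pos[of 2] pos[of 3]
          distortion_cells[OF less.prems] by (simp add: field_simps)
      finally show ?thesis .
    qed
  qed
qed

end

subsection \<open>Words and the upper bound\<close>

lemma words_0 [simp]: "words 0 = {[]}"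
  by (auto simp: words_def)

lemma words_Suc: "words (Suc l) = (\<Union>j\<in>{1,2,3}. (#) j ` words l)"
  by (auto simp: words_def length_Suc_conv image_iff)

lemma finite_words [simp]: "finite (words l)"
  by (induction l) (auto simp: words_Suc)

lemma sum_words_Suc:
  "(\<Sum>\<sigma>\<in>words (Suc l). f \<sigma>) = (\<Sum>\<sigma>\<in>words l. f (1 # \<sigma>) + f (2 # \<sigma>) + f (3 # \<sigma>))"
proof -
  have "(\<Sum>\<sigma>\<in>words (Suc l). f \<sigma>) = (\<Sum>j\<in>{1,2,3}. \<Sum>\<sigma>\<in>(#) j ` words l. f \<sigma>)"
    unfolding words_Suc by (rule sum.UNION_disjoint) auto
  also have "\<dots> = (\<Sum>j\<in>{1,2,3}. \<Sum>\<sigma>\<in>words l. f (j # \<sigma>))"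
    by (rule sum.cong[OF refl]) (simp add: sum.reindex)
  finally show ?thesis by (simp add: sum.distrib add.assoc)
qed

lemma card_words: "card (words l) = 3 ^ l"
proof (induction l)
  case (Suc l)
  have "card (words (Suc l)) = (\<Sum>\<sigma>\<in>words (Suc l). 1)" by simp
  also have "\<dots> = 3 ^ Suc l" unfolding sum_words_Suc using Suc by simp
  finally show ?case .
qed simp

lemma S_word_affine: "S_word r \<sigma> x = r ^ length \<sigma> * x + S_word r \<sigma> 0"
proof (induction \<sigma> arbitrary: x)
  case (Cons j \<sigma>)
  show ?case using Cons[of x] by (simp add: S_def algebra_simps)
qed simp

lemma ell_bounds:
  assumes "1 \<le> n"
  shows "3 ^ ell n \<le> n" "n < 3 ^ (ell n + 1)"
proof -
  have "\<exists>l. 3 ^ l \<le> n \<and> n < 3 ^ (l + 1)"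
    using ex_power_ivl1[of 3 n] assms by auto
  moreover have "l = l'" if "3 ^ l \<le> n \<and> n < 3 ^ (l + 1)" "3 ^ l' \<le> n \<and> n < 3 ^ (l' + 1)" for l l'
  proof -
    have "(3::nat) ^ l < 3 ^ (l' + 1)" "(3::nat) ^ l' < 3 ^ (l + 1)" using that by linarith+
    from this[THEN power_less_imp_less_exp[rotated]] show ?thesis by simp
  qed
  ultimately have "\<exists>!l. 3 ^ l \<le> n \<and> n < 3 ^ (l + 1)" by blast
  from theI'[OF this] show "3 ^ ell n \<le> n" "n < 3 ^ (ell n + 1)" by (simp_all add: ell_def)
qed

context self_similar
begin

text \<open>The first letter is the outermost map, so the induction applies to \<open>f\<close>
  composed with \<open>S r j\<close> and prolongs words at the front.\<close>

lemma integral_words: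
  fixes f :: "real \<Rightarrow> real"
  assumes "continuous_on UNIV f"
  shows "3 ^ l * (LINT x|P. f x) = (\<Sum>\<sigma>\<in>words l. LINT x|P. f (S_word r \<sigma> x))"
  using assms
proof (induction l arbitrary: f)
  case (Suc l)
  have IH: "3 ^ l * (LINT x|P. f (S r j x)) = (\<Sum>\<sigma>\<in>words l. LINT x|P. f (S_word r (j # \<sigma>) x))" for j
    using Suc.IH[of "\<lambda>x. f (S r j x)"] continuous_on_compose2[OF Suc.prems continuous_S]
    by simp
  have "3 ^ Suc l * (LINT x|P. f x) = 3 ^ l * (3 * (LINT x|P. f x))" by simp
  also have "\<dots> = 3 ^ l * (LINT x|P. f (S r 1 x)) + 3 ^ l * (LINT x|P. f (S r 2 x))
      + 3 ^ l * (LINT x|P. f (S r 3 x))"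
    unfolding integral_self_similar[OF Suc.prems] by (simp add: algebra_simps)
  also have "\<dots> = (\<Sum>\<sigma>\<in>words (Suc l). LINT x|P. f (S_word r \<sigma> x))"
    unfolding IH sum_words_Suc sum.distrib ..
  finally show ?case .
qed simp

text \<open>Restricting each cylinder to its own points can only raise the error;
  \<open>S_word r \<sigma>\<close> scales squared distances by \<open>r ^ (2 * l)\<close>.\<close>

lemma distortion_le_words:
  assumes "finite \<alpha>"
    and \<gamma>: "\<And>\<sigma>. \<sigma> \<in> words l \<Longrightarrow> finite (\<gamma> \<sigma>) \<and> \<gamma> \<sigma> \<noteq> {} \<and> S_word r \<sigma> ` \<gamma> \<sigma> \<subseteq> \<alpha>"
  shows "3 ^ l * distortion P \<alpha> \<le> r ^ (2 * l) * (\<Sum>\<sigma>\<in>words l. distortion P (\<gamma> \<sigma>))"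
proof -
  have "replicate l 1 \<in> words l" by (auto simp: words_def)
  then have "\<alpha> \<noteq> {}" using \<gamma> by fastforce
  note cont = continuous_min_sq_dist[OF assms(1) \<open>\<alpha> \<noteq> {}\<close>]
  have cS: "continuous_on UNIV (S_word r \<sigma>)" for \<sigma>
    by (subst S_word_affine[abs_def]) (intro continuous_intros)
  have "(LINT x|P. min_sq_dist \<alpha> (S_word r \<sigma> x)) \<le> r ^ (2 * l) * distortion P (\<gamma> \<sigma>)"
    if \<sigma>: "\<sigma> \<in> words l" for \<sigma>
  proof -
    have "(LINT x|P. min_sq_dist \<alpha> (S_word r \<sigma> x)) \<le> (LINT x|P. r ^ (2 * l) * min_sq_dist (\<gamma> \<sigma>) x)"
    proof (rule integral_mono_unit)
      show "continuous_on UNIV (\<lambda>x. min_sq_dist \<alpha> (S_word r \<sigma> x))"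
        using continuous_on_compose2[OF cont cS] by blast
      show "continuous_on UNIV (\<lambda>x. r ^ (2 * l) * min_sq_dist (\<gamma> \<sigma>) x)"
        using \<gamma>[OF \<sigma>] by (intro continuous_intros continuous_min_sq_dist) auto
      fix x :: real
      obtain a where a: "a \<in> \<gamma> \<sigma>" "min_sq_dist (\<gamma> \<sigma>) x = (x - a)\<^sup>2"
        using min_sq_dist_attained[of "\<gamma> \<sigma>" x] \<gamma>[OF \<sigma>] by metis
      have "min_sq_dist \<alpha> (S_word r \<sigma> x) \<le> (S_word r \<sigma> x - S_word r \<sigma> a)\<^sup>2"
        using a(1) \<gamma>[OF \<sigma>] by (intro min_sq_dist_le assms(1)) auto
      also have "S_word r \<sigma> x - S_word r \<sigma> a = r ^ l * (x - a)"
        using \<sigma> S_word_affine[of r \<sigma> x] S_word_affine[of r \<sigma> a]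
        by (simp add: words_def algebra_simps)
      finally show "min_sq_dist \<alpha> (S_word r \<sigma> x) \<le> r ^ (2 * l) * min_sq_dist (\<gamma> \<sigma>) x"
        by (simp add: a(2) power_mult_distrib power_mult[symmetric] mult.commute)
    qed
    then show ?thesis by (simp add: distortion_min_sq_dist)
  qed
  then have "(\<Sum>\<sigma>\<in>words l. LINT x|P. min_sq_dist \<alpha> (S_word r \<sigma> x))
      \<le> (\<Sum>\<sigma>\<in>words l. r ^ (2 * l) * distortion P (\<gamma> \<sigma>))"
    by (rule sum_mono)
  then show ?thesis
    using integral_words[OF cont] by (simp add: distortion_min_sq_dist sum_distrib_left)
qed

section \<open>The sets \<open>beta2\<close> and \<open>beta3\<close> and their errors\<close>

lemma J_last_two: "J r [2] \<union> J r [3] = {(1 - r) / 2..(1 + r) / 2} \<union> {1 - r..1}"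
proof -
  have img: "S r j ` {0..1} = {S r j 0..S r j 1}" for j
    unfolding S_def using r_pos image_affinity_atLeastAtMost[of r "(real j - 1) / 2 * (1 - r)" 0 1]
    by (simp add: algebra_simps)
  show ?thesis by (simp add: J_def img) (simp add: S_def field_simps)
qed

text \<open>Two cylinders of equal mass average their centres 1/2 and
  \<open>1 - r / 2\<close>.\<close>

lemma a_mean_last_two: "a_mean P r {[2], [3]} = 3 / 4 - r / 4"
proof -
  define A where "A = {(1 - r) / 2..(1 + r) / 2} \<union> {1 - r..1}"
  have [measurable]: "A \<in> sets borel" unfolding A_def by measurable
  have notin: "S r 1 x \<notin> A" if "x \<in> {0..1}" for x
  proof -
    have "r * x \<le> r" using that r_pos by (auto intro: mult_left_le)
    then show ?thesis using r_less unfolding A_def S_alt by auto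
  qed
  have "in": "S r 2 x \<in> A" "S r 3 x \<in> A" if "x \<in> {0..1}" for x
  proof -
    define y where "y = r * x"
    have "0 \<le> y" "y \<le> r" using that r_pos by (auto simp: y_def intro: mult_left_le)
    then show "S r 2 x \<in> A" "S r 3 x \<in> A"
      unfolding A_def S_alt y_def[symmetric] by (auto simp: field_simps)
  qed
  \<comment> \<open>The indicator vanishes on the first cylinder and is 1 on the others; the
    identity function yields the numerator, the constant 1 the mass 2/3.\<close>
  have part: "3 * (LINT x|P. indicator A x * f x) = (LINT x|P. f (S r 2 x)) + (LINT x|P. f (S r 3 x))"
    if cont: "continuous_on UNIV f" for f :: "real \<Rightarrow> real"
  proof -
    have [measurable]: "f \<in> borel_measurable borel"
      using cont by (rule borel_measurable_continuous_onI)
    obtain B where "\<forall>x\<in>{0..1}. \<bar>f x\<bar> \<le> B"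
      using continuous_bounded_unit[OF cont] ..
    then have "\<bar>indicator A x * f x\<bar> \<le> B" if "x \<in> {0..1}" for x
      using that by (force simp: indicator_def)
    then have "3 * (LINT x|P. indicator A x * f x) = (LINT x|P. indicator A (S r 1 x) * f (S r 1 x))
        + (LINT x|P. indicator A (S r 2 x) * f (S r 2 x))
        + (LINT x|P. indicator A (S r 3 x) * f (S r 3 x))"
      by (intro integral_self_similar_bounded) auto
    also have "(LINT x|P. indicator A (S r 1 x) * f (S r 1 x)) = (LINT x|P. 0)"
      by (rule integral_cong_AE, measurable)
        (use AE_unit in \<open>eventually_elim, use notin in auto\<close>)
    also have "(LINT x|P. indicator A (S r 2 x) * f (S r 2 x)) = (LINT x|P. f (S r 2 x))"
      by (rule integral_cong_AE, measurable) (use AE_unit in \<open>eventually_elim, use "in" in auto\<close>)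
    also have "(LINT x|P. indicator A (S r 3 x) * f (S r 3 x)) = (LINT x|P. f (S r 3 x))"
      by (rule integral_cong_AE, measurable) (use AE_unit in \<open>eventually_elim, use "in" in auto\<close>)
    finally show ?thesis by simp
  qed
  have i: "integrable P (\<lambda>x. x)" by (rule integrable_continuous) auto
  have mean_S: "(LINT x|P. S r j x) = S r j (1 / 2)" for j
    using i mean by (simp add: S_def)
  have "3 * (LINT x|P. indicator A x * x) = (LINT x|P. S r 2 x) + (LINT x|P. S r 3 x)"
    by (rule part) auto
  then have int: "(LINT x|P. indicator A x * x) = 1 / 2 - r / 6"
    unfolding mean_S unfolding S_alt by (simp add: field_simps)
  have prob: "measure P A = 2 / 3"
    using part[of "\<lambda>x. 1"] by simp
  have "a_mean P r {[2], [3]} = (LINT x|P. indicator A x * x) / measure P A"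
    unfolding a_mean_def set_lebesgue_integral_def by (simp add: J_last_two A_def Un_commute)
  then show ?thesis unfolding int prob by (simp add: field_simps)
qed

lemma beta2_eq: "beta2 P r = {r / 2, 3 / 4 - r / 4}"
  unfolding beta2_def a_mean_last_two by (simp add: a_pt_def S_def)

lemma beta3_eq: "beta3 r = {r / 2, 1 / 2, 1 - r / 2}"
  by (simp add: beta3_def a_pt_def S_def field_simps)

text \<open>The first cylinder is served by its centre, the other two by a point at distance
  \<open>(1 - r) / 4\<close> from each centre; \<open>v_eq\<close> turns the total into
  \<open>3 * err 2\<close>.\<close>

lemma distortion_beta2_le: "distortion P (beta2 P r) \<le> err 2"
proof -
  let ?\<alpha> = "{r / 2, 3 / 4 - r / 4}"
  have \<alpha>: "finite ?\<alpha>" "?\<alpha> \<noteq> {}" by auto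
  have "3 * distortion P ?\<alpha> \<le> (r\<^sup>2 * V + (S r 1 (1 / 2) - r / 2)\<^sup>2)
      + (r\<^sup>2 * V + (S r 2 (1 / 2) - (3 / 4 - r / 4))\<^sup>2) + (r\<^sup>2 * V + (S r 3 (1 / 2) - (3 / 4 - r / 4))\<^sup>2)"
    unfolding distortion_cells[OF \<alpha>] by (intro add_mono cell_distortion_le) auto
  also have "\<dots> = 3 * (r\<^sup>2 * V) + (1 - r)\<^sup>2 / 8"
    unfolding S_alt by (simp add: power2_eq_square field_simps)
  also have "\<dots> = 3 * err 2"
    unfolding err_2 using v_eq by (simp add: algebra_simps)
  finally show ?thesis by (simp add: beta2_eq)
qed

lemma distortion_beta3_le: "distortion P (beta3 r) \<le> err 3"
proof -
  let ?\<alpha> = "{r / 2, 1 / 2, 1 - r / 2}"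
  have \<alpha>: "finite ?\<alpha>" "?\<alpha> \<noteq> {}" by auto
  have "3 * distortion P ?\<alpha> \<le> (r\<^sup>2 * V + (S r 1 (1 / 2) - r / 2)\<^sup>2)
      + (r\<^sup>2 * V + (S r 2 (1 / 2) - 1 / 2)\<^sup>2) + (r\<^sup>2 * V + (S r 3 (1 / 2) - (1 - r / 2))\<^sup>2)"
    unfolding distortion_cells[OF \<alpha>] by (intro add_mono cell_distortion_le) auto
  also have "\<dots> = 3 * err 3"
    unfolding err_3 S_alt by (simp add: field_simps)
  finally show ?thesis by (simp add: beta3_eq)
qed

end

section \<open>Closed formulas for the error sequence\<close>

context gap_sequence
begin

text \<open>The linear piece with \<open>p = 1\<close>, rewritten as interpolation between its two
  ends.\<close>

lemma err_first_third:
  assumes "3 ^ l \<le> n" "n \<le> 2 * 3 ^ l"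
  shows "3 ^ l * err n
    = (3 * q) ^ l * ((2 * 3 ^ l - real n) * err 1 + (real n - 3 ^ l) * err 2)"
proof -
  obtain i where i: "n = 3 ^ l * 1 + i" "i \<le> 3 ^ l"
    using assms by (auto simp: le_iff_add)
  have e: "err n = (3 * q) ^ l * err 1 - real i * (q ^ l * d\<^sub>1)"
    using err_pow3_linear[of 1 i l] i by simp
  show ?thesis
    unfolding e err_2 by (simp add: i(1) power_mult_distrib algebra_simps)
qed

text \<open>The piece with \<open>p = 2\<close>. It meets the piece with \<open>p = 1\<close> at
  \<open>n = 2 * 3 ^ l\<close>, as do the two formulas of the theorem.\<close>

lemma err_last_third:
  assumes "2 * 3 ^ l \<le> n" "n \<le> 3 ^ (l + 1)"
  shows "3 ^ l * err n
    = (3 * q) ^ l * ((3 ^ (l + 1) - real n) * err 2 + (real n - 2 * 3 ^ l) * err 3)"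
proof -
  obtain i where i: "n = 3 ^ l * 2 + i" "i \<le> 3 ^ l"
    using assms by (auto simp: le_iff_add)
  have e: "err n = (3 * q) ^ l * err 2 - real i * (q ^ l * d\<^sub>2)"
    using err_pow3_linear[of 2 i l] i by simp
  have e3: "err 3 = err 2 - d\<^sub>2"
    using err_Suc[of 2] by simp
  show ?thesis
    unfolding e e3 by (simp add: i(1) power_mult_distrib algebra_simps)
qed

end

section \<open>Optimality of the sets \<open>beta P r n I\<close>\<close>

context self_similar_25
begin

text \<open>The explicit upper bound meets the general lower bound; since \<open>err\<close> is
  antitone, a cardinality of at most 2 suffices.\<close>

lemma distortion_beta2: "distortion P (beta2 P r) = err 2"
proof (rule antisym)
  have c: "1 \<le> card (beta2 P r)" "card (beta2 P r) \<le> 2"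
    by (simp_all add: beta2_def card_insert_if)
  show "err 2 \<le> distortion P (beta2 P r)"
    using err_antimono[OF c] err_le_distortion[of "beta2 P r"] by (simp add: beta2_def)
qed (rule distortion_beta2_le)

lemma distortion_beta3: "distortion P (beta3 r) = err 3"
proof (rule antisym)
  have c: "1 \<le> card (beta3 r)" "card (beta3 r) \<le> 3"
    by (simp_all add: beta3_def card_insert_if)
  show "err 3 \<le> distortion P (beta3 r)"
    using err_antimono[OF c] err_le_distortion[of "beta3 r"] by (simp add: beta3_def)
qed (rule distortion_beta3_le)

text \<open>As \<open>err n\<close> bounds every competitor from below, a set reaching it makes the
  infimum a minimum. Competitors may have fewer than \<open>n\<close> points, where
  \<open>err_antimono\<close> enters.\<close>

lemma optimal_if_distortion_le_err:
  assumes "finite \<alpha>" "\<alpha> \<noteq> {}" "card \<alpha> \<le> n" "distortion P \<alpha> \<le> err n"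
  shows "optimal_set_of_means P n \<alpha>" "quant_error P n = err n" "distortion P \<alpha> = err n"
proof -
  have lower: "err n \<le> distortion P \<beta>" if "finite \<beta>" "\<beta> \<noteq> {}" "card \<beta> \<le> n" for \<beta>
  proof -
    have "1 \<le> card \<beta>" using that by (simp add: Suc_le_eq card_gt_0_iff)
    then show ?thesis using err_antimono[of "card \<beta>" n] err_le_distortion[of \<beta>] that by simp
  qed
  then show d: "distortion P \<alpha> = err n" using assms by (intro antisym) auto
  show q: "quant_error P n = err n"
    unfolding quant_error_def
  proof (rule cInf_eq_minimum)
    show "err n \<in> distortion P ` {\<alpha>. finite \<alpha> \<and> \<alpha> \<noteq> {} \<and> card \<alpha> \<le> n}"
      using assms d by force
  qed (use lower in auto)
  show "optimal_set_of_means P n \<alpha>"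
    using assms d q by (simp add: optimal_set_of_means_def)
qed

text \<open>The common shape of both branches of \<open>beta\<close>: words outside \<open>I\<close>
  carry a copy of \<gamma>, words in \<open>I\<close> a copy of \<gamma>'. An upper bound on the
  cardinality is enough, so copies may overlap.\<close>

lemma distortion_partition_le_err:
  assumes I: "I \<subseteq> words l"
    and \<gamma>: "finite \<gamma>" "\<gamma> \<noteq> {}" and \<gamma>': "finite \<gamma>'" "\<gamma>' \<noteq> {}"
  defines "\<alpha> \<equiv> (\<Union>\<omega>\<in>words l - I. S_word r \<omega> ` \<gamma>) \<union> (\<Union>\<omega>\<in>I. S_word r \<omega> ` \<gamma>')"
  shows "finite \<alpha>" "\<alpha> \<noteq> {}" "card \<alpha> \<le> (3 ^ l - card I) * card \<gamma> + card I * card \<gamma>'"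
    "3 ^ l * distortion P \<alpha>
      \<le> r ^ (2 * l) * ((3 ^ l - real (card I)) * distortion P \<gamma> + real (card I) * distortion P \<gamma>')"
proof -
  have fI: "finite I" using I by (rule finite_subset) simp
  have cI: "card (words l - I) = 3 ^ l - card I"
    using I fI by (simp add: card_Diff_subset card_words)
  have cI_le: "card I \<le> 3 ^ l"
    using card_mono[OF finite_words I] by (simp add: card_words)
  show fin: "finite \<alpha>" unfolding \<alpha>_def using fI \<gamma> \<gamma>' by simp
  have "replicate l 1 \<in> words l" by (auto simp: words_def)
  then show "\<alpha> \<noteq> {}" unfolding \<alpha>_def using \<gamma>(2) \<gamma>'(2) by blast
  have "card (\<Union>\<omega>\<in>A. S_word r \<omega> ` \<delta>) \<le> card A * card \<delta>" if "finite A" "finite \<delta>" for A and \<delta> :: "real set"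
  proof -
    have "card (\<Union>\<omega>\<in>A. S_word r \<omega> ` \<delta>) \<le> (\<Sum>\<omega>\<in>A. card (S_word r \<omega> ` \<delta>))"
      by (rule card_UN_le[OF that(1)])
    also have "\<dots> \<le> (\<Sum>\<omega>\<in>A. card \<delta>)" by (intro sum_mono card_image_le that)
    finally show ?thesis by simp
  qed
  from this[of "words l - I" \<gamma>] this[of I \<gamma>'] show "card \<alpha> \<le> (3 ^ l - card I) * card \<gamma> + card I * card \<gamma>'"
    unfolding \<alpha>_def using \<gamma>(1) \<gamma>'(1) fI cI by (intro order_trans[OF card_Un_le]) auto
  have "3 ^ l * distortion P \<alpha>
      \<le> r ^ (2 * l) * (\<Sum>\<sigma>\<in>words l. distortion P (if \<sigma> \<in> I then \<gamma>' else \<gamma>))"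
    using \<gamma> \<gamma>' by (intro distortion_le_words[OF fin]) (auto simp: \<alpha>_def)
  also have "(\<Sum>\<sigma>\<in>words l. distortion P (if \<sigma> \<in> I then \<gamma>' else \<gamma>))
      = (\<Sum>\<sigma>\<in>words l - I. distortion P \<gamma>) + (\<Sum>\<sigma>\<in>I. distortion P \<gamma>')"
    unfolding sum.subset_diff[OF I finite_words] by simp
  also have "\<dots> = (3 ^ l - real (card I)) * distortion P \<gamma> + real (card I) * distortion P \<gamma>'"
    using cI cI_le by (simp add: of_nat_diff)
  finally show "3 ^ l * distortion P \<alpha>
      \<le> r ^ (2 * l) * ((3 ^ l - real (card I)) * distortion P \<gamma> + real (card I) * distortion P \<gamma>')" .
qed

lemma beta_optimal:
  assumes "1 \<le> n" "admissible n I"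
  shows "optimal_set_of_means P n (beta P r n I)" "quant_error P n = err n"
    "distortion P (beta P r n I) = err n"
proof -
  define l where "l = ell n"
  note bounds = ell_bounds[OF assms(1), folded l_def]
  have I: "I \<subseteq> words l" using assms(2) by (simp add: admissible_def l_def)
  have rq: "(3 * (r\<^sup>2 / 3)) ^ l = r ^ (2 * l)" by (simp add: power_mult)
  have "finite (beta P r n I) \<and> beta P r n I \<noteq> {} \<and> card (beta P r n I) \<le> n
      \<and> distortion P (beta P r n I) \<le> err n"
  proof (cases "n \<le> 2 * 3 ^ l")
    case True
    have cI: "card I = n - 3 ^ l" using assms(2) bounds True by (simp add: admissible_def l_def)
    \<comment> \<open>The points \<open>a_pt r \<omega>\<close> are copies of the single mean 1/2,
      whose error is \<open>err 1\<close>.\<close>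
    have beta: "beta P r n I = (\<Union>\<omega>\<in>words l - I. S_word r \<omega> ` {1 / 2}) \<union> (\<Union>\<omega>\<in>I. S_word r \<omega> ` beta2 P r)"
      using True by (auto simp: beta_def l_def a_pt_def)
    note * = distortion_partition_le_err[OF I, of "{1 / 2}" "beta2 P r", folded beta]
    have c2: "card (beta2 P r) \<le> 2" "finite (beta2 P r)" "beta2 P r \<noteq> {}"
      by (simp_all add: beta2_def card_insert_if)
    have "card I * card (beta2 P r) \<le> card I * 2" using c2(1) by (rule mult_le_mono2)
    moreover have "card (beta P r n I) \<le> (3 ^ l - card I) + card I * card (beta2 P r)"
      using *(3) c2 by simp
    \<comment> \<open>The count is \<open>(3 ^ l - card I) + 2 * card I = n\<close>; the truncated
      subtraction is exact because \<open>n \<le> 2 * 3 ^ l\<close>.\<close>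
    ultimately have "card (beta P r n I) \<le> n" using cI bounds True by linarith
    moreover have "3 ^ l * distortion P (beta P r n I) \<le> 3 ^ l * err n"
      unfolding err_first_third[OF bounds(1) True] rq
      using *(4) c2 cI bounds by (simp add: distortion_beta2 distortion_singleton of_nat_diff)
    ultimately show ?thesis using *(1,2) c2 by simp
  next
    case False
    have cI: "card I = n - 2 * 3 ^ l"
      using assms(2) bounds False by (simp add: admissible_def l_def)
    have beta: "beta P r n I = (\<Union>\<omega>\<in>words l - I. S_word r \<omega> ` beta2 P r) \<union> (\<Union>\<omega>\<in>I. S_word r \<omega> ` beta3 r)"
      using False by (simp add: beta_def l_def)
    note * = distortion_partition_le_err[OF I, of "beta2 P r" "beta3 r", folded beta]
    have c: "card (beta2 P r) \<le> 2" "finite (beta2 P r)" "beta2 P r \<noteq> {}"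
      "card (beta3 r) \<le> 3" "finite (beta3 r)" "beta3 r \<noteq> {}"
      by (simp_all add: beta2_def beta3_def card_insert_if)
    have "(3 ^ l - card I) * card (beta2 P r) \<le> (3 ^ l - card I) * 2"
      "card I * card (beta3 r) \<le> card I * 3"
      using c by (simp_all only: mult_le_mono2)
    moreover have "card (beta P r n I)
        \<le> (3 ^ l - card I) * card (beta2 P r) + card I * card (beta3 r)"
      using *(3) c by simp
    \<comment> \<open>This gives \<open>card I \<le> 3 ^ l\<close>, so
      \<open>2 * (3 ^ l - card I) + 3 * card I = n\<close> holds in the naturals.\<close>
    moreover have "n < 3 * 3 ^ l" using bounds(2) by simp
    ultimately have "card (beta P r n I) \<le> n" using cI False by linarith
    moreover have "3 ^ l * distortion P (beta P r n I) \<le> 3 ^ l * err n"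
      using *(4) c cI bounds False err_last_third[of l n] unfolding rq
      by (simp add: distortion_beta2 distortion_beta3 of_nat_diff)
    ultimately show ?thesis using *(1,2) c by simp
  qed
  then show "optimal_set_of_means P n (beta P r n I)" "quant_error P n = err n"
    "distortion P (beta P r n I) = err n"
    by (auto intro: optimal_if_distortion_le_err)
qed

end

theorem theorem3p5:
  fixes r :: real and P :: "real measure" and n :: nat and I :: "nat list set"
  assumes "r = 1 / 25"
    and "self_similar_measure r P"
    and "n \<ge> 3"
    and "admissible n I"
  shows "optimal_set_of_means P n (beta P r n I) \<and>
    quant_error P n = distortion P (beta P r n I) \<and>
    (3 ^ ell n \<le> n \<and> n \<le> 2 * 3 ^ ell n \<longrightarrow>
      distortion P (beta P r n I) = 1 / 3 ^ ell n * r ^ (2 * ell n) *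
        ((2 * 3 ^ ell n - real n) * prob_space.variance P (\<lambda>x. x)
          + (real n - 3 ^ ell n) * distortion P (beta2 P r))) \<and>
    (2 * 3 ^ ell n \<le> n \<and> n < 3 ^ (ell n + 1) \<longrightarrow>
      distortion P (beta P r n I) = 1 / 3 ^ ell n * r ^ (2 * ell n) *
        ((3 ^ (ell n + 1) - real n) * distortion P (beta2 P r)
          + (real n - 2 * 3 ^ ell n) * distortion P (beta3 r)))"
proof -
  interpret self_similar_25 r P
    by unfold_locales (use assms in auto)
  have n: "1 \<le> n" using assms(3) by simp
  have rq: "(3 * (r\<^sup>2 / 3)) ^ ell n = r ^ (2 * ell n)" by (simp add: power_mult)
  have V: "prob_space.variance P (\<lambda>x. x) = err 1" by (simp add: V_def[symmetric])
  \<comment> \<open>Both formulas are read off from \<open>err n\<close>, so the second one also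
    holds at \<open>n = 2 * 3 ^ ell n\<close>, where \<open>beta\<close> takes its first
    branch.\<close>
  show ?thesis
    unfolding V distortion_beta2 distortion_beta3 beta_optimal[OF n assms(4)]
    using beta_optimal(1)[OF n assms(4)] err_first_third[of "ell n" n, unfolded rq]
      err_last_third[of "ell n" n, unfolded rq]
    by (simp add: field_simps)
qed

end
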